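(* Let $\Omega=\mathbb{R}^N_+$ with $N\ge2$. Let $\varphi\in L^\infty(\Omega)$, $\varphi_b\in L^\infty(\partial\Omega)$, let $K\subset\overline\Omega$ be compact and $0<\tau_1<\tau_2<\infty$. For $\varepsilon\in(0,1)$ let $u_\varepsilon=v_\varepsilon+w_\varepsilon$ be the global-in-time solution described in the context. Then there is $C>0$ such that $$\sup_{\tau_1<t<\tau_2}\|u_\varepsilon(\cdot,t)-S_2(t)\varphi_b\|_{L^\infty(K)}\le C\sqrt{\varepsilon}\qquad\text{for every }\varepsilon\in(0,1).$$
   Context: Setting: $\Omega=\mathbb{R}^N_+=\mathbb{R}^{N-1}\times(0,\infty)$, points $x=(x',x_N)$; $\partial\Omega$ is identified with $\mathbb{R}^{N-1}$; $\partial_\nu=-\partial_{x_N}$ (on all of $\overline\Omega$). The problem is $$\varepsilon\partial_tu_\varepsilon-\Delta u_\varepsilon=0\ \text{in }\Omega\times(0,\infty),\quad \partial_tu_\varepsilon+\partial_\nu u_\varepsilon=0\ \text{on }\partial\Omega\times(0,\infty),\quad u_\varepsilon(\cdot,0)=\varphi\ \text{in }\Omega,\quad u_\varepsilon(\cdot,0)=\varphi_b\ \text{on }\partial\Omega.$$ Dirichlet heat semigroup: with $y_*=(y',-y_N)$, $$[S_1(t)\phi](x)=(4\pi t)^{-N/2}\int_{\mathbb{R}^N_+}\Big(e^{-\frac{|x-y|^2}{4t}}-e^{-\frac{|x-y_*|^2}{4t}}\Big)\phi(y)\,dy .$$ Harmonic functions with dynamical boundary condition: for $\psi\in L^\infty(\partial\Omega)$,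 $$[S_2(t)\psi](x)=\frac{\Gamma(N/2)}{\pi^{N/2}}\int_{\mathbb{R}^{N-1}}(x_N+t)^{1-N}\Big(1+\frac{|x'-y'|^2}{(x_N+t)^2}\Big)^{-N/2}\psi(y')\,dy',$$ so that $p(t)=S_2(t)\psi$ solves $-\Delta p=0$ in $\Omega$, $\partial_tp+\partial_\nu p=0$ on $\partial\Omega$, $p(\cdot,0)=\psi$ on $\partial\Omega$. Solution: put $\Phi=\varphi-S_2(0)\varphi_b$. A pair $(v_\varepsilon,w_\varepsilon)$ with $v_\varepsilon,\partial_\nu v_\varepsilon,w_\varepsilon\in C(\overline\Omega\times(0,\infty))$ is a global-in-time solution if for $x\in\Omega$, $t>0$ $$w_\varepsilon(x,t)=[S_2(t)\varphi_b](x)-\int_0^t[S_2(t-s)\,\partial_\nu v_\varepsilon|_{\partial\Omega}(\cdot,s)](x)\,ds,$$ $$v_\varepsilon(x,t)=[S_1(t/\varepsilon)\Phi](x)-\int_0^t[S_1((t-s)/\varepsilon)\,\partial_tw_\varepsilon(\cdot,s)](x)\,ds,$$ where $\partial_tw_\varepsilon=F_1[\varphi_b]+F_2[v_\varepsilon]$ with $F_1[\varphi_b](x,t)=\partial_t[S_2(t)\varphi_b](x)$ and $$F_2[v](x,t)=-[S_2(0)\,\partial_\nu v|_{\partial\Omega}(\cdot,t)](x)-\int_0^t\partial_t[S_2(t-s)\,\partial_\nu v|_{\partial\Omega}(\cdot,s)](x)\,ds.$$ Known fact (prior work): for every $\varepsilon\in(0,1)$, $\varphi\in L^\infty(\Omega)$,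 $\varphi_b\in L^\infty(\partial\Omega)$ there is a unique global-in-time solution $(v_\varepsilon,w_\varepsilon)$ such that $\sup_{0<t<T}\big(\|v_\varepsilon(\cdot,t)\|_{L^\infty(\Omega)}+\sqrt{t/\varepsilon}\,\|\partial_\nu v_\varepsilon(\cdot,t)\|_{L^\infty(\Omega)}+\|w_\varepsilon(\cdot,t)\|_{L^\infty(\Omega)}\big)<\infty$ for every $T>0$, and this supremum is bounded by $C(T)(\|\varphi\|_{L^\infty(\Omega)}+\|\varphi_b\|_{L^\infty(\partial\Omega)})$ with $C(T)$ independent of $\varepsilon$, $\varphi$, $\varphi_b$. The function $u_\varepsilon:=v_\varepsilon+w_\varepsilon$ in the claim is built from this solution. *)

theory Defs
  imports "HOL-Probability.Essential_Supremum"
begin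

text \<open>
  Points of \<open>\<real>\<^sup>N\<close> are pairs \<open>(x', x\<^sub>N)\<close> of type \<^typ>\<open>'a::euclidean_space \<times> real\<close>,
  where \<^typ>\<open>'a\<close> plays the role of \<open>\<real>\<^sup>N\<^sup>-\<^sup>1\<close> and of the boundary of the half-space.
  Hence \<open>N = DIM('a \<times> real) = DIM('a) + 1 \<ge> 2\<close>, every such \<open>N\<close> occurs, and the norm on
  pairs is the Euclidean one.
\<close>

definition half_space :: "('a::euclidean_space \<times> real) set" where
  "half_space = {x. 0 < snd x}"

text \<open>
  The essential supremum is taken in \<^typ>\<open>ennreal\<close>, so that it is \<open>0\<close> (and not \<open>-\<infinity>\<close>) on null
  sets; for a non-measurable argument it is \<open>\<infinity>\<close>.
\<close>

definition Linf_norm :: "'b::euclidean_space set \<Rightarrow> ('b \<Rightarrow> real) \<Rightarrow> ennreal" where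
  "Linf_norm S f = esssup (lebesgue_on S) (\<lambda>x. ennreal \<bar>f x\<bar>)"

definition Linf :: "'b::euclidean_space set \<Rightarrow> ('b \<Rightarrow> real) set" where
  "Linf S = {f. f \<in> borel_measurable (lebesgue_on S) \<and> Linf_norm S f < \<infinity>}"


definition dirichlet_kernel ::
    "real \<Rightarrow> 'a::euclidean_space \<times> real \<Rightarrow> 'a \<times> real \<Rightarrow> real" where
  "dirichlet_kernel t x y =
     exp (- (norm (x - y))\<^sup>2 / (4 * t)) - exp (- (norm (x - (fst y, - snd y)))\<^sup>2 / (4 * t))"

definition S1 ::
    "real \<Rightarrow> ('a::euclidean_space \<times> real \<Rightarrow> real) \<Rightarrow> 'a \<times> real \<Rightarrow> real" where
  "S1 t \<phi> x = (4 * pi * t) powr (- real DIM('a \<times> real) / 2) *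
     (LINT y:half_space|lebesgue. dirichlet_kernel t x y * \<phi> y)"

text \<open>Only used where \<open>x\<^sub>N + t > 0\<close>.\<close>

definition S2 :: "real \<Rightarrow> ('a::euclidean_space \<Rightarrow> real) \<Rightarrow> 'a \<times> real \<Rightarrow> real" where
  "S2 t \<psi> x = Gamma (real DIM('a \<times> real) / 2) / pi powr (real DIM('a \<times> real) / 2) *
     (LINT y'|lebesgue. (snd x + t) powr (1 - real DIM('a \<times> real)) *
        (1 + (norm (fst x - y'))\<^sup>2 / (snd x + t)\<^sup>2) powr (- real DIM('a \<times> real) / 2) * \<psi> y')"


text \<open>The outer normal derivative \<open>- \<partial>f/\<partial>x\<^sub>N\<close>, one-sided at boundary points.\<close>

definition normal_differentiable ::
    "('a::euclidean_space \<times> real \<Rightarrow> real) \<Rightarrow> 'a \<times> real \<Rightarrow> bool" where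
  "normal_differentiable f x \<longleftrightarrow> (\<lambda>r. f (fst x, r)) differentiable (at (snd x) within {0..})"

definition normal_deriv ::
    "('a::euclidean_space \<times> real \<Rightarrow> real) \<Rightarrow> 'a \<times> real \<Rightarrow> real" where
  "normal_deriv f x = - vector_derivative (\<lambda>r. f (fst x, r)) (at (snd x) within {0..})"

text \<open>Functions of space and time are written \<open>v x t\<close>; the trace below is
  \<open>\<partial>\<^sub>\<nu>v(\<cdot>, t)\<close> restricted to the boundary.\<close>

definition normal_trace ::
    "('a::euclidean_space \<times> real \<Rightarrow> real \<Rightarrow> real) \<Rightarrow> real \<Rightarrow> 'a \<Rightarrow> real" where
  "normal_trace v t y' = normal_deriv (\<lambda>x. v x t) (y', 0)"

definition F1 :: "('a::euclidean_space \<Rightarrow> real) \<Rightarrow> 'a \<times> real \<Rightarrow> real \<Rightarrow> real" where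
  "F1 \<phi>b x t = deriv (\<lambda>r. S2 r \<phi>b x) t"

definition F2 ::
    "('a::euclidean_space \<times> real \<Rightarrow> real \<Rightarrow> real) \<Rightarrow> 'a \<times> real \<Rightarrow> real \<Rightarrow> real" where
  "F2 v x t = - S2 0 (normal_trace v t) x -
     (LINT s:{0<..<t}|lebesgue. deriv (\<lambda>r. S2 (r - s) (normal_trace v s) x) t)"

text \<open>
  Bochner integrals of non-integrable functions are \<open>0\<close>, so the convergence of the integrals
  occurring in the two integral equations is part of the definition.
\<close>

definition global_solution ::
    "real \<Rightarrow> ('a::euclidean_space \<times> real \<Rightarrow> real) \<Rightarrow> ('a \<Rightarrow> real) \<Rightarrow>
     ('a \<times> real \<Rightarrow> real \<Rightarrow> real) \<Rightarrow> ('a \<times> real \<Rightarrow> real \<Rightarrow> real) \<Rightarrow> bool" where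
  "global_solution \<epsilon> \<phi> \<phi>b v w \<longleftrightarrow>
     continuous_on (closure half_space \<times> {0<..}) (\<lambda>(x, t). v x t) \<and>
     (\<forall>x\<in>closure half_space. \<forall>t>0. normal_differentiable (\<lambda>z. v z t) x) \<and>
     continuous_on (closure half_space \<times> {0<..}) (\<lambda>(x, t). normal_deriv (\<lambda>z. v z t) x) \<and>
     continuous_on (closure half_space \<times> {0<..}) (\<lambda>(x, t). w x t) \<and>
     (\<forall>x\<in>half_space. \<forall>t>0.
        set_integrable lebesgue {0<..<t} (\<lambda>s. S2 (t - s) (normal_trace v s) x) \<and>
        w x t = S2 t \<phi>b x - (LINT s:{0<..<t}|lebesgue. S2 (t - s) (normal_trace v s) x)) \<and>
     (\<forall>x\<in>half_space. \<forall>t>0.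
        set_integrable lebesgue {0<..<t} (\<lambda>s. deriv (\<lambda>r. S2 (r - s) (normal_trace v s) x) t)) \<and>
     (\<forall>x\<in>half_space. \<forall>t>0.
        (\<forall>s\<in>{0<..<t}. set_integrable lebesgue half_space
           (\<lambda>y. dirichlet_kernel ((t - s) / \<epsilon>) x y * (F1 \<phi>b y s + F2 v y s))) \<and>
        set_integrable lebesgue {0<..<t}
          (\<lambda>s. S1 ((t - s) / \<epsilon>) (\<lambda>y. F1 \<phi>b y s + F2 v y s) x) \<and>
        v x t = S1 (t / \<epsilon>) (\<lambda>y. \<phi> y - S2 0 \<phi>b y) x -
          (LINT s:{0<..<t}|lebesgue. S1 ((t - s) / \<epsilon>) (\<lambda>y. F1 \<phi>b y s + F2 v y s) x))"

text \<open>The class of solutions in which the solution is unique.\<close>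

definition locally_bounded_solution ::
    "real \<Rightarrow> ('a::euclidean_space \<times> real \<Rightarrow> real \<Rightarrow> real) \<Rightarrow>
     ('a \<times> real \<Rightarrow> real \<Rightarrow> real) \<Rightarrow> bool" where
  "locally_bounded_solution \<epsilon> v w \<longleftrightarrow>
     (\<forall>T>0. (SUP t\<in>{0<..<T}.
        Linf_norm half_space (\<lambda>x. v x t) +
        ennreal (sqrt (t / \<epsilon>)) * Linf_norm half_space (normal_deriv (\<lambda>x. v x t)) +
        Linf_norm half_space (\<lambda>x. w x t)) < \<infinity>)"

end

theory Submission
  imports Defs "HOL-Probability.Distributions"
begin

text \<open>
  The Dirichlet kernel is dominated by \<open>x\<^sub>N / sqrt t\<close> times a wider Gaussian, so bounds on the
  source term give \<open>\<bar>v x t\<bar> \<le> x\<^sub>N * b\<close> in the half-space. Such an inequality already controls the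
  boundary trace, \<open>\<bar>\<partial>\<^sub>\<nu>v\<bar> \<le> b\<close>, without differentiating the representation formula.
  Since the source term is in turn bounded by the trace, this closes on itself: if
  \<open>\<bar>\<partial>\<^sub>\<nu>v\<bar> \<le> A * exp (l * t) * sqrt (\<epsilon> / t)\<close> on \<open>(0, T)\<close>, then the same holds with
  \<open>C1 + A / 2\<close> in place of \<open>A\<close> once \<open>l\<close> is large, hence with \<open>2 * C1\<close>, and \<open>C1\<close>, \<open>l\<close> do not
  depend on \<open>\<epsilon>\<close>. This yields \<open>v = O(sqrt \<epsilon>)\<close> on compact sets, and \<open>w - S2 t \<phi>b\<close> is a time integral
  of \<open>S2\<close> applied to the trace, thus also \<open>O(sqrt \<epsilon>)\<close>.
\<close>

section \<open>Gaussian, Poisson and beta integrals\<close>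

text \<open>The exponents are dictated by the factor \<open>1 / (y_N + s)\<close> that bounds
  \<open>F1\<close> and, with \<open>s - r\<close> in place of \<open>s\<close>, the time derivative
  inside \<open>F2\<close>. Estimated by the time variable alone it is not integrable in time;
  estimated by \<open>1 / y_N\<close> alone it is not integrable against the widened Gaussian at the
  boundary. The product \<open>y_N powr (-1/2) * s powr (-1/2)\<close> is integrable in both
  respects. On data of size \<open>y_N powr (-1/2)\<close> the Dirichlet semigroup costs
  \<open>t powr (-3/4)\<close> instead of the \<open>t powr (-1/2)\<close> for bounded data, which
  leaves a margin of 1/4 before integrability in time is lost; half of this margin pays for the
  small factor \<open>l powr (-1/8)\<close> gained from the exponential weight. At time
  \<open>t / \<epsilon>\<close> the two rates give \<open>sqrt \<epsilon>\<close> and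
  \<open>\<epsilon> powr (3/4)\<close>, and the latter is at most \<open>sqrt \<epsilon>\<close>
  because \<open>\<epsilon> < 1\<close>. The absorption needs some finite \<open>A\<close> to start
  from; the class of solutions supplies one for each \<epsilon>, and repeated halving removes its
  dependence on \<epsilon>.\<close>

lemma abs_integral_le:
  fixes f :: "'b \<Rightarrow> real"
  assumes "(\<integral>\<^sup>+x. ennreal \<bar>f x\<bar> \<partial>M) \<le> ennreal c" "0 \<le> c"
  shows "\<bar>LINT x|M. f x\<bar> \<le> c"
proof (cases "integrable M f")
  case True
  then have "ennreal \<bar>LINT x|M. f x\<bar> \<le> (\<integral>\<^sup>+x. ennreal \<bar>f x\<bar> \<partial>M)"
    using integral_norm_bound_ennreal[of M f] by simp
  with assms show ?thesis
    by (metis ennreal_le_iff order_trans)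
next
  \<comment> \<open>The Bochner integral is \<open>0\<close> here, which satisfies the bound as
    well. Later estimates of integrals therefore need only a majorant of the integrand.\<close>
  case False
  then show ?thesis using assms by (simp add: not_integrable_integral_eq)
qed

lemma abs_set_integral_le:
  fixes f :: "'b \<Rightarrow> real"
  assumes "(\<integral>\<^sup>+x\<in>A. ennreal \<bar>f x\<bar> \<partial>M) \<le> ennreal c" "0 \<le> c"
  shows "\<bar>LINT x:A|M. f x\<bar> \<le> c"
proof -
  have "(\<integral>\<^sup>+x. ennreal \<bar>indicator A x *\<^sub>R f x\<bar> \<partial>M) = (\<integral>\<^sup>+x\<in>A. ennreal \<bar>f x\<bar> \<partial>M)"
    by (intro nn_integral_cong) (auto simp: indicator_def)
  then show ?thesis
    unfolding set_lebesgue_integral_def using assms by (intro abs_integral_le) auto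
qed

text \<open>The integrand is \<open>sqrt (pi * s)\<close> times the normal density with mean
  \<open>x\<close> and variance \<open>s / 2\<close>.\<close>

lemma nn_integral_gaussian_real:
  fixes x s :: real
  assumes "0 < s"
  shows "(\<integral>\<^sup>+y. ennreal (exp (- (x - y)\<^sup>2 / s)) \<partial>lborel) = ennreal (sqrt (pi * s))"
proof -
  define \<sigma> where "\<sigma> = sqrt (s / 2)"
  have \<sigma>: "0 < \<sigma>" "2 * \<sigma>\<^sup>2 = s" using assms by (auto simp: \<sigma>_def)
  have norm: "2 * pi * \<sigma>\<^sup>2 = pi * s"
    by (simp flip: \<sigma>(2))
  have *: "exp (- (x - y)\<^sup>2 / s) = sqrt (pi * s) * normal_density x \<sigma> y" for y
    unfolding normal_density_def norm \<sigma>(2) power2_commute[of x y] using assms by simp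
  interpret prob_space "density lborel (\<lambda>y. ennreal (normal_density x \<sigma> y))"
    using \<sigma>(1) by (rule prob_space_normal_density)
  have "(\<integral>\<^sup>+y. ennreal (normal_density x \<sigma> y) \<partial>lborel) = 1"
    using emeasure_space_1 by (simp add: emeasure_density)
  then show ?thesis
    unfolding * using assms by (simp add: ennreal_mult' nn_integral_cmult)
qed

lemma norm_power2_eq_sum_Basis:
  "(norm (x::'a::euclidean_space))\<^sup>2 = (\<Sum>b\<in>Basis. (x \<bullet> b)\<^sup>2)"
  by (subst power2_norm_eq_inner, subst euclidean_inner) (simp add: power2_eq_square)

lemma nn_integral_gaussian:
  fixes x :: "'a::euclidean_space"
  assumes "0 < s"
  shows "(\<integral>\<^sup>+y. ennreal (exp (- (norm (x - y))\<^sup>2 / s)) \<partial>lborel) = ennreal (sqrt (pi * s) ^ DIM('a))"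
proof -
  have "exp (- (norm (x - y))\<^sup>2 / s) = (\<Prod>b\<in>Basis. exp (- (x \<bullet> b - y \<bullet> b)\<^sup>2 / s))" for y
    unfolding norm_power2_eq_sum_Basis
    by (simp add: exp_sum sum_divide_distrib sum_negf[symmetric] inner_diff_left)
  then have "(\<integral>\<^sup>+y. ennreal (exp (- (norm (x - y))\<^sup>2 / s)) \<partial>lborel) =
      (\<integral>\<^sup>+y. (\<Prod>b\<in>Basis. ennreal (exp (- (x \<bullet> b - y \<bullet> b)\<^sup>2 / s))) \<partial>lborel)"
    by (simp add: prod_ennreal)
  also have "\<dots> = (\<Prod>b\<in>(Basis::'a set). ennreal (sqrt (pi * s)))"
    using assms
    by (subst nn_integral_lborel_prod)
      (auto intro!: prod.cong simp: nn_integral_gaussian_real[simplified] simp del: prod_constant)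
  also have "\<dots> = ennreal (sqrt (pi * s) ^ DIM('a))"
    using assms by (simp add: ennreal_power)
  finally show ?thesis .
qed

text \<open>Comparison with 1 on \<open>{-1..1}\<close> and with the power \<open>-2*q\<close> of
  the absolute value outside; \<open>h\<close> is the majorant of the right tail and its reflection
  that of the left one.\<close>

lemma nn_integral_Cauchy_power_finite:
  fixes q :: real
  assumes "1 / 2 < q"
  shows "(\<integral>\<^sup>+z. ennreal ((1 + z\<^sup>2) powr (-q)) \<partial>lborel) < \<infinity>"
proof -
  define h where "h z = ennreal (z powr (-2*q)) * indicator {1..} z" for z :: real
  have hm [measurable]: "h \<in> borel_measurable borel" unfolding h_def by measurable
  have h: "(\<integral>\<^sup>+z. h z \<partial>lborel) < \<infinity>"
    unfolding h_def
    using nn_integral_has_integral_lebesgue'[OF _ has_integral_powr_to_inf[of "-2*q" 1]] assms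
    by auto
  have h': "(\<integral>\<^sup>+z. h (- z) \<partial>lborel) = (\<integral>\<^sup>+z. h z \<partial>lborel)"
    using nn_integral_real_affine[of h "-1" 0] by simp
  have tail: "(1 + z\<^sup>2) powr (-q) \<le> \<bar>z\<bar> powr (-2*q)" if "1 < \<bar>z\<bar>" for z :: real
  proof -
    have "\<bar>z\<bar> powr (-2*q) = (z\<^sup>2) powr (-q)"
      using that powr_powr[of "\<bar>z\<bar>" 2 "-q"] by simp
    moreover have "(1 + z\<^sup>2) powr (-q) \<le> (z\<^sup>2) powr (-q)"
      using that assms by (intro powr_mono2') auto
    ultimately show ?thesis by simp
  qed
  have mid: "(1 + z\<^sup>2) powr (-q) \<le> 1" for z :: real
    using powr_mono2'[of "-q" 1 "1 + z\<^sup>2"] assms by simp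
  have "ennreal ((1 + z\<^sup>2) powr (-q)) \<le> indicator {-1..1} z + (h z + h (- z))" for z
  proof (cases "\<bar>z\<bar> \<le> 1")
    case True
    then have "z \<in> {-1..1}" by auto
    then show ?thesis using mid[of z]
      by (metis ennreal_1 ennreal_leI indicator_simps(1) add_increasing2 zero_le)
  next
    case False
    then have "h z + h (-z) = ennreal (\<bar>z\<bar> powr (-2*q))"
      by (auto simp: h_def indicator_def abs_if)
    with tail[of z] False show ?thesis by (simp add: ennreal_leI add_increasing)
  qed
  then have "(\<integral>\<^sup>+z. ennreal ((1 + z\<^sup>2) powr (-q)) \<partial>lborel) \<le>
      (\<integral>\<^sup>+z. indicator {-1..1} z + (h z + h (- z)) \<partial>lborel)"
    by (intro nn_integral_mono) auto
  also have "\<dots> = 2 + (2 * (\<integral>\<^sup>+z. h z \<partial>lborel))"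
    by (simp add: nn_integral_add h' mult_2)
  also have "\<dots> < \<infinity>"
    using h by (auto simp: ennreal_mult_less_top top_unique less_top[symmetric] ennreal_mult_eq_top_iff)
  finally show ?thesis .
qed

text \<open>The left side is a product of \<open>DIM('a)\<close> equal powers, and each factor
  increases when only one coordinate is kept. This replaces the Poisson kernel by a tensor product,
  at the price of an inexact constant.\<close>

lemma one_plus_norm_powr_le_prod:
  fixes z :: "'a::euclidean_space"
  assumes "0 \<le> p"
  shows "(1 + (norm z)\<^sup>2) powr (-p) \<le> (\<Prod>b\<in>Basis. (1 + (z \<bullet> b)\<^sup>2) powr (- p / DIM('a)))"
proof -
  define r where "r = (1 + (norm z)\<^sup>2) powr (- p / DIM('a))"
  have "r ^ DIM('a) = r powr real DIM('a)"
    by (subst powr_realpow) (auto simp: r_def add_pos_nonneg add_nonneg_eq_0_iff)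
  also have "\<dots> = (1 + (norm z)\<^sup>2) powr (-p)"
    by (simp add: r_def powr_powr)
  finally have "(1 + (norm z)\<^sup>2) powr (-p) = (\<Prod>b\<in>(Basis::'a set). (1 + (norm z)\<^sup>2) powr (- p / DIM('a)))"
    by (simp add: r_def)
  also have "\<dots> \<le> (\<Prod>b\<in>Basis. (1 + (z \<bullet> b)\<^sup>2) powr (- p / DIM('a)))"
  proof (intro prod_mono conjI powr_mono2')
    fix b :: 'a assume "b \<in> Basis"
    then show "1 + (z \<bullet> b)\<^sup>2 \<le> 1 + (norm z)\<^sup>2"
      using Basis_le_norm[of b z] by (simp add: abs_le_square_iff[symmetric])
  qed (use assms in \<open>auto simp: add_pos_nonneg\<close>)
  finally show ?thesis .
qed

text \<open>With \<open>n = DIM('a)\<close> the exponent per coordinate is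
  \<open>q = (n + 1) / (2 * n)\<close>, just above the threshold 1/2 of convergence. Rescaling every
  coordinate by \<open>\<rho>\<close> produces \<open>\<rho> ^ n\<close>, which cancels the
  prefactor; hence the uniformity in \<open>\<rho>\<close>.\<close>

lemma nn_integral_Poisson_kernel_bound:
  "\<exists>C>0. \<forall>\<rho>>0. \<forall>x::'a::euclidean_space.
     (\<integral>\<^sup>+y. ennreal (\<rho> powr (- real DIM('a)) *
        (1 + (norm (x - y))\<^sup>2 / \<rho>\<^sup>2) powr (- real (DIM('a) + 1) / 2)) \<partial>lborel) \<le> ennreal C"
proof -
  define p where "p = real (DIM('a) + 1) / 2"
  define q where "q = p / DIM('a)"
  have q: "1 / 2 < q" by (simp add: q_def p_def field_simps)
  define c where "c = enn2real (\<integral>\<^sup>+z. ennreal ((1 + z\<^sup>2) powr (-q)) \<partial>lborel)"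
  have c: "(\<integral>\<^sup>+z. ennreal ((1 + z\<^sup>2) powr (-q)) \<partial>lborel) = ennreal c" "0 \<le> c"
    using nn_integral_Cauchy_power_finite[OF q] by (auto simp: c_def less_top)
  have one: "(\<integral>\<^sup>+z. ennreal ((1 + ((t - z) / \<rho>)\<^sup>2) powr (-q)) \<partial>lborel) = ennreal (\<rho> * c)"
    if "0 < \<rho>" for \<rho> t :: real
  proof -
    have "(\<integral>\<^sup>+z. ennreal ((1 + ((t - z) / \<rho>)\<^sup>2) powr (-q)) \<partial>lborel) =
      ennreal \<rho> * (\<integral>\<^sup>+z. ennreal ((1 + ((t - (t + \<rho> * z)) / \<rho>)\<^sup>2) powr (-q)) \<partial>lborel)"
      using nn_integral_real_affine[of "\<lambda>z. ennreal ((1 + ((t - z) / \<rho>)\<^sup>2) powr (-q))" \<rho> t] that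
      by simp
    also have "(\<integral>\<^sup>+z. ennreal ((1 + ((t - (t + \<rho> * z)) / \<rho>)\<^sup>2) powr (-q)) \<partial>lborel) = ennreal c"
      using that c by simp
    finally show ?thesis using that c by (simp add: ennreal_mult)
  qed
  have "(\<integral>\<^sup>+y. ennreal (\<rho> powr (- real DIM('a)) *
        (1 + (norm (x - y))\<^sup>2 / \<rho>\<^sup>2) powr (- p)) \<partial>lborel) \<le> ennreal (c ^ DIM('a))"
    if \<rho>: "0 < \<rho>" for \<rho> and x :: 'a
  proof -
    have le: "(1 + (norm (x - y))\<^sup>2 / \<rho>\<^sup>2) powr (- p)
        \<le> (\<Prod>b\<in>Basis. (1 + ((x \<bullet> b - y \<bullet> b) / \<rho>)\<^sup>2) powr (- q))" for y
      using one_plus_norm_powr_le_prod[of p "(1 / \<rho>) *\<^sub>R (x - y)"] \<rho>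
      by (simp add: q_def p_def power_divide inner_diff_left)
    have "(\<integral>\<^sup>+y. ennreal (\<rho> powr (- real DIM('a)) *
        (1 + (norm (x - y))\<^sup>2 / \<rho>\<^sup>2) powr (- p)) \<partial>lborel)
      \<le> (\<integral>\<^sup>+y. ennreal (\<rho> powr (- real DIM('a))) *
          (\<Prod>b\<in>Basis. ennreal ((1 + ((x \<bullet> b - y \<bullet> b) / \<rho>)\<^sup>2) powr (- q))) \<partial>lborel)"
      using le by (intro nn_integral_mono)
        (simp add: prod_ennreal ennreal_mult[symmetric] prod_nonneg ennreal_leI mult_left_mono)
    also have "\<dots> = ennreal (\<rho> powr (- real DIM('a))) *
        (\<integral>\<^sup>+y. (\<Prod>b\<in>Basis. ennreal ((1 + ((x \<bullet> b - y \<bullet> b) / \<rho>)\<^sup>2) powr (- q))) \<partial>lborel)"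
      by (intro nn_integral_cmult) measurable
    also have "(\<integral>\<^sup>+y. (\<Prod>b\<in>Basis. ennreal ((1 + ((x \<bullet> b - y \<bullet> b) / \<rho>)\<^sup>2) powr (- q))) \<partial>lborel)
        = (\<Prod>b\<in>(Basis::'a set). ennreal (\<rho> * c))"
      using \<rho> by (subst nn_integral_lborel_prod) (simp_all add: one)
    also have "ennreal (\<rho> powr (- real DIM('a))) * (\<Prod>b\<in>(Basis::'a set). ennreal (\<rho> * c))
        = ennreal (c ^ DIM('a))"
      using \<rho> c by (simp add: ennreal_power ennreal_mult[symmetric] powr_minus powr_realpow power_mult_distrib)
    finally show ?thesis .
  qed
  \<comment> \<open>The summand 1 gives a strictly positive constant from \<open>0 \<le> c\<close>
    alone.\<close>
  then have "\<forall>\<rho>>0. \<forall>x::'a. (\<integral>\<^sup>+y. ennreal (\<rho> powr (- real DIM('a)) *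
        (1 + (norm (x - y))\<^sup>2 / \<rho>\<^sup>2) powr (- real (DIM('a) + 1) / 2)) \<partial>lborel)
        \<le> ennreal (c ^ DIM('a) + 1)"
    unfolding p_def minus_divide_left by (meson ennreal_leI less_add_one less_imp_le order_trans)
  moreover have "0 < c ^ DIM('a) + 1" using c(2) by (simp add: add_nonneg_pos)
  ultimately show ?thesis by blast
qed

text \<open>The substitution \<open>s = t * u\<close> reduces this to Euler's beta integral. The
  exponents \<open>a\<close> and \<open>b\<close> measure the singularities at the upper and at the
  lower end.\<close>

lemma nn_integral_beta:
  fixes t a b :: real
  assumes "a < 1" "b < 1" "0 < t"
  shows "(\<integral>\<^sup>+s\<in>{0<..<t}. ennreal ((t - s) powr (-a) * s powr (-b)) \<partial>lborel)
    = ennreal (Beta (1 - b) (1 - a) * t powr (1 - a - b))"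
proof -
  let ?f = "\<lambda>s. ennreal ((t - s) powr (-a) * s powr (-b)) * indicator {0<..<t} s"
  have B: "0 \<le> Beta (1 - b) (1 - a)"
    using assms by (simp add: Beta_def)
  have "((\<lambda>u. u powr (-b) * (1 - u) powr (-a)) has_integral Beta (1 - b) (1 - a)) {0<..<1}"
    using has_integral_Beta_real[of "1 - b" "1 - a"] assms by (simp add: has_integral_Icc_iff_Ioo)
  then have *: "(\<integral>\<^sup>+u. ennreal (u powr (-b) * (1 - u) powr (-a)) * indicator {0<..<1} u \<partial>lborel)
      = ennreal (Beta (1 - b) (1 - a))"
    by (intro nn_integral_has_integral_lebesgue') auto
  have "integral\<^sup>N lborel ?f = ennreal t * (\<integral>\<^sup>+u. ?f (0 + t * u) \<partial>lborel)"
    using nn_integral_real_affine[of ?f t 0] assms by simp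
  also have "(\<integral>\<^sup>+u. ?f (0 + t * u) \<partial>lborel) = (\<integral>\<^sup>+u. ennreal (t powr (-a-b)) *
      (ennreal (u powr (-b) * (1 - u) powr (-a)) * indicator {0<..<1} u) \<partial>lborel)"
  proof (intro nn_integral_cong)
    fix u :: real
    show "?f (0 + t * u) = ennreal (t powr (-a-b)) *
      (ennreal (u powr (-b) * (1 - u) powr (-a)) * indicator {0<..<1} u)"
    proof (cases "0 < u \<and> u < 1")
      case True
      have "t - t * u = t * (1 - u)" by (simp add: algebra_simps)
      then have "(t - t * u) powr a = t powr a * (1 - u) powr a"
        by (simp add: powr_mult)
      then show ?thesis using True assms
        by (simp add: powr_mult ennreal_mult[symmetric] powr_diff powr_minus field_simps)
    next
      case False
      then have "\<not> (0 < t * u \<and> t * u < t)"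
        using assms by (auto simp: zero_less_mult_iff)
      then show ?thesis using False by auto
    qed
  qed
  also have "\<dots> = ennreal (t powr (-a-b)) * ennreal (Beta (1 - b) (1 - a))"
    by (subst nn_integral_cmult) (simp_all add: *)
  also have "ennreal t * \<dots> = ennreal (Beta (1 - b) (1 - a) * t powr (1 - a - b))"
  proof -
    have "t powr (1 - a - b) = t * t powr (-a-b)"
      using assms powr_add[of t 1 "-a-b"] by (simp add: algebra_simps)
    then show ?thesis using assms B by (simp add: ennreal_mult[symmetric] mult_ac)
  qed
  finally show ?thesis .
qed

section \<open>The Dirichlet heat semigroup\<close>

lemma norm_power2_prod: "(norm (x :: 'a::euclidean_space \<times> real))\<^sup>2 = (norm (fst x))\<^sup>2 + (snd x)\<^sup>2"
  by (cases x) (simp add: norm_Pair)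

text \<open>Reflecting \<open>y\<close> at the boundary increases the squared distance to
  \<open>x\<close> by \<open>4 * snd x * snd y\<close>.\<close>

lemma dirichlet_kernel_eq:
  assumes "0 < t"
  shows "dirichlet_kernel t x y =
    exp (- (norm (x - y))\<^sup>2 / (4 * t)) * (1 - exp (- (snd x * snd y) / t))"
proof -
  have "- (norm (x - (fst y, - snd y)))\<^sup>2 / (4 * t) =
      - (norm (x - y))\<^sup>2 / (4 * t) + - (snd x * snd y) / t"
    unfolding norm_power2_prod using assms by (simp add: field_simps power2_eq_square)
  then show ?thesis
    unfolding dirichlet_kernel_def by (simp only: exp_add right_diff_distrib mult_1_right)
qed

text \<open>Half of the Gaussian exponent is sacrificed: the kernel is
  \<open>F * (F * (1 - e))\<close>, and one \<open>F\<close> survives in the bound. For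
  \<open>sqrt t \<le> snd x\<close> the factor \<open>snd x / sqrt t\<close> is at least 1 and
  nothing is to be gained. Otherwise \<open>1 - e\<close> is at most
  \<open>snd x * snd y / t\<close>, where \<open>snd y \<le> sqrt t + d\<close> may be large, but
  the second \<open>F\<close> compensates the growth in \<open>d\<close>.\<close>

lemma dirichlet_kernel_bound:
  assumes t: "0 < t" and x: "0 < snd x" and y: "0 < snd y"
  shows "\<bar>dirichlet_kernel t x y\<bar> \<le> 3 * (snd x / sqrt t) * exp (- (norm (x - y))\<^sup>2 / (8 * t))"
proof -
  define d where "d = norm (x - y)"
  define z where "z = d / sqrt t"
  define F where "F = exp (- d\<^sup>2 / (8 * t))"
  define e where "e = exp (- (snd x * snd y) / t)"
  have "0 \<le> z" using t by (simp add: z_def d_def)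
  have z2: "d\<^sup>2 / (8 * t) = z\<^sup>2 / 8"
    using t by (simp add: z_def power_divide)
  have e: "e \<le> 1" "1 - e \<le> 1" "1 - e \<le> snd x * snd y / t"
    using t x y exp_ge_add_one_self[of "- (snd x * snd y) / t"] by (auto simp: e_def)
  have F: "0 \<le> F" "F \<le> 1" using t by (auto simp: F_def)
  have K: "dirichlet_kernel t x y = F * (F * (1 - e))"
  proof -
    have "exp (- d\<^sup>2 / (4 * t)) = F * F"
      by (simp add: F_def exp_add[symmetric])
    then show ?thesis using t by (simp add: dirichlet_kernel_eq d_def e_def)
  qed
  have "F * (1 - e) \<le> 3 * (snd x / sqrt t)"
  proof (cases "sqrt t \<le> snd x")
    case True
    have "F * (1 - e) \<le> 1 * 1" using F e by (intro mult_mono) auto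
    also have "1 * 1 \<le> snd x / sqrt t" using True t by simp
    also have "\<dots> \<le> 3 * (snd x / sqrt t)" using x t by (simp add: divide_right_mono)
    finally show ?thesis .
  next
    case False
    have "\<bar>snd z\<bar> \<le> norm z" for z :: "'a \<times> real"
      using norm_snd_le[of "snd z" "fst z"] by simp
    from this[of "y - x"] have "snd (y - x) \<le> norm (y - x)" by simp
    then have "snd y \<le> sqrt t + d" using False by (simp add: d_def norm_minus_commute)
    then have "snd y / sqrt t \<le> 1 + z" using t by (simp add: z_def field_simps)
    also have "\<dots> \<le> 3 * (1 + z\<^sup>2 / 8)"
    proof -
      \<comment> \<open>From \<open>z - 4\<close> squared one gets \<open>z \<le> 2 + q / 8\<close>
        with \<open>q\<close> the square of \<open>z\<close>; this is the origin of the constant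
        3.\<close>
      have "0 \<le> z\<^sup>2 - 8 * z + 16" using zero_le_power2[of "z - 4"] by (simp add: power2_diff)
      moreover define q where "q = z\<^sup>2"
      ultimately have "0 \<le> q - 8 * z + 16" "0 \<le> q" by simp_all
      then have "1 + z \<le> 3 * (1 + q / 8)" by simp
      then show ?thesis by (simp add: q_def)
    qed
    also have "\<dots> \<le> 3 * exp (d\<^sup>2 / (8 * t))"
      unfolding z2 by (intro mult_left_mono exp_ge_add_one_self) simp
    also have "\<dots> = 3 / F" by (simp add: F_def exp_minus field_simps)
    finally have "F * (snd y / sqrt t) \<le> 3" using F_def by (simp add: field_simps)
    then have h1: "(snd x / sqrt t) * (F * (snd y / sqrt t)) \<le> (snd x / sqrt t) * 3"
      using x t by (intro mult_left_mono) auto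
    have h2: "F * (snd x * snd y / t) = (snd x / sqrt t) * (F * (snd y / sqrt t))"
      using t by (simp add: field_simps)
    have h3: "F * (1 - e) \<le> F * (snd x * snd y / t)"
      using e F by (intro mult_left_mono) auto
    from order_trans[OF h3[unfolded h2] h1] show ?thesis by (simp only: mult.commute)
  qed
  then have "F * (F * (1 - e)) \<le> F * (3 * (snd x / sqrt t))"
    using F by (intro mult_left_mono) auto
  moreover have "0 \<le> F * (F * (1 - e))" using F e by simp
  ultimately show ?thesis unfolding K by (simp add: F_def d_def mult_ac)
qed

text \<open>In the boundary layer the decay of the Gaussian in normal direction is given up, so that
  the integral factorizes; \<open>2 * sqrt c\<close> is the integral of the singular weight over the
  layer.\<close>

lemma nn_integral_gaussian_strip:
  fixes x :: "'a::euclidean_space \<times> real"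
  assumes "0 < s" "0 < c"
  shows "(\<integral>\<^sup>+y. ennreal (exp (- (norm (x - y))\<^sup>2 / s)) *
      (ennreal (snd y powr (-1/2)) * indicator {0..c} (snd y)) \<partial>lborel)
    \<le> ennreal (sqrt (pi * s) ^ DIM('a) * (2 * sqrt c))"
proof -
  have *: "(\<integral>\<^sup>+r. ennreal (r powr (-1/2)) * indicator {0..c} r \<partial>lborel) = ennreal (2 * sqrt c)"
    using nn_integral_has_integral_lebesgue'[OF _ has_integral_powr_from_0[of "-1/2" c]] assms
    by (simp add: powr_half_sqrt)
  let ?g = "\<lambda>y::'a. ennreal (exp (- (norm (fst x - y))\<^sup>2 / s))"
  let ?h = "\<lambda>r::real. ennreal (r powr (-1/2)) * indicator {0..c} r"
  have "(\<integral>\<^sup>+y. ennreal (exp (- (norm (x - y))\<^sup>2 / s)) * ?h (snd y) \<partial>lborel)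
      \<le> (\<integral>\<^sup>+y. ?g (fst y) * ?h (snd y) \<partial>lborel)"
  proof (intro nn_integral_mono mult_right_mono ennreal_leI)
    fix y :: "'a \<times> real"
    show "exp (- (norm (x - y))\<^sup>2 / s) \<le> exp (- (norm (fst x - fst y))\<^sup>2 / s)"
      unfolding norm_power2_prod using assms by (simp add: divide_simps)
  qed auto
  also have "\<dots> = (\<integral>\<^sup>+y. ?g (fst y) * ?h (snd y) \<partial>(lborel \<Otimes>\<^sub>M lborel))"
    by (simp add: lborel_prod)
  also have "\<dots> = (\<integral>\<^sup>+y. \<integral>\<^sup>+r. ?g y * ?h r \<partial>lborel \<partial>lborel)"
    by (subst lborel.nn_integral_fst[symmetric]) simp_all
  also have "\<dots> = ennreal (sqrt (pi * s) ^ DIM('a)) * ennreal (2 * sqrt c)"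
    using assms by (simp add: nn_integral_cmult nn_integral_multc *[simplified] nn_integral_gaussian[simplified])
  finally show ?thesis using assms by (simp add: ennreal_mult)
qed

text \<open>The kernel bound contributes \<open>snd x / sqrt t\<close>. The singular part of the
  data is integrated over the layer \<open>snd y \<le> sqrt t\<close>, and above the layer it is at
  most \<open>b * q\<close> with \<open>q = t powr (-1/4)\<close>. Both parts are of the same order,
  which explains the rate \<open>t powr (-3/4)\<close>. Each dimension contributes
  \<open>sqrt 2\<close> because the Gaussian in the bound is wider than the one in the
  normalization.\<close>

lemma S1_bound:
  fixes f :: "'a::euclidean_space \<times> real \<Rightarrow> real"
  assumes t: "0 < t" and ab: "0 \<le> a" "0 \<le> b" and x: "x \<in> half_space"
    and f: "AE y in lebesgue. y \<in> half_space \<longrightarrow> \<bar>f y\<bar> \<le> a + b * snd y powr (-1/2)"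
  shows "\<bar>S1 t f x\<bar> \<le> 6 * sqrt 2 ^ DIM('a \<times> real) * snd x * (a * t powr (-1/2) + b * t powr (-3/4))"
proof -
  define N where "N = DIM('a \<times> real)"
  define R where "R = sqrt (pi * (8 * t))"
  define q where "q = t powr (-1/4)"
  have q: "0 < q" "sqrt (sqrt t) = 1 / q"
  proof -
    have "sqrt (sqrt t) = t powr (1/4)"
      using t by (simp add: powr_half_sqrt[symmetric] powr_powr)
    then show "0 < q" "sqrt (sqrt t) = 1 / q" using t by (auto simp: q_def powr_minus_divide)
  qed
  have R: "0 < R" using t by (simp add: R_def)
  have x0: "0 < snd x" using x by (simp add: half_space_def)
  define k where "k = 3 * (snd x / sqrt t)"
  have k: "0 \<le> k" using x0 t by (simp add: k_def)
  let ?E = "\<lambda>y. exp (- (norm (x - y))\<^sup>2 / (8 * t))"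
  let ?h = "\<lambda>r::real. ennreal (r powr (-1/2)) * indicator {0..sqrt t} r"
  have split: "ennreal (a + b * r powr (-1/2)) \<le> ennreal (a + b * q) + ennreal b * ?h r"
    if "0 < r" for r
  proof (cases "r \<le> sqrt t")
    case True
    then show ?thesis using that ab q
      by (simp add: ennreal_mult[symmetric] ennreal_plus[symmetric] del: ennreal_plus)
  next
    case False
    have "r powr (-1/2) \<le> (sqrt t) powr (-1/2)"
      using False t by (intro powr_mono2') auto
    also have "\<dots> = q" using t by (simp add: q_def powr_half_sqrt[symmetric] powr_powr)
    finally have "a + b * r powr (-1/2) \<le> a + b * q" using ab by (simp add: mult_left_mono)
    then show ?thesis using False by (simp add: ennreal_leI del: ennreal_plus)
  qed
  have [measurable]: "(\<lambda>y::'a \<times> real. snd y) \<in> borel_measurable borel"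
    by (intro borel_measurable_continuous_onI continuous_intros)
  have "(\<integral>\<^sup>+y\<in>half_space. ennreal \<bar>dirichlet_kernel t x y * f y\<bar> \<partial>lebesgue)
      \<le> (\<integral>\<^sup>+y. ennreal k * (ennreal (a + b * q) * ennreal (?E y)
            + ennreal b * (ennreal (?E y) * ?h (snd y))) \<partial>lebesgue)"
  proof (intro nn_integral_mono_AE, use f in eventually_elim)
    fix y :: "'a \<times> real"
    assume f: "y \<in> half_space \<longrightarrow> \<bar>f y\<bar> \<le> a + b * snd y powr (-1/2)"
    show "ennreal \<bar>dirichlet_kernel t x y * f y\<bar> * indicator half_space y
      \<le> ennreal k * (ennreal (a + b * q) * ennreal (?E y)
            + ennreal b * (ennreal (?E y) * ?h (snd y)))"
    proof (cases "y \<in> half_space")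
      case True
      then have y: "0 < snd y" by (simp add: half_space_def)
      have "ennreal \<bar>dirichlet_kernel t x y * f y\<bar> = ennreal \<bar>dirichlet_kernel t x y\<bar> * ennreal \<bar>f y\<bar>"
        by (simp add: abs_mult ennreal_mult)
      also have "\<dots> \<le> ennreal (k * ?E y) * ennreal (a + b * snd y powr (-1/2))"
        using dirichlet_kernel_bound[OF t x0 y] f True
        by (intro mult_mono ennreal_leI) (auto simp: k_def)
      also have "\<dots> \<le> ennreal (k * ?E y) * (ennreal (a + b * q) + ennreal b * ?h (snd y))"
        using split[OF y] by (intro mult_left_mono) auto
      finally show ?thesis using True k by (simp add: ennreal_mult algebra_simps)
    qed auto
  qed
  also have "\<dots> = ennreal k * (ennreal (a + b * q) * (\<integral>\<^sup>+y. ennreal (?E y) \<partial>lborel)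
      + ennreal b * (\<integral>\<^sup>+y. ennreal (?E y) * ?h (snd y) \<partial>lborel))"
    unfolding nn_integral_completion by (simp add: nn_integral_cmult nn_integral_add)
  also have "\<dots> \<le> ennreal k * (ennreal (a + b * q) * ennreal (R ^ N)
      + ennreal b * ennreal (R ^ DIM('a) * (2 * sqrt (sqrt t))))"
    using nn_integral_gaussian[of "8 * t" x] nn_integral_gaussian_strip[of "8 * t" "sqrt t" x] t
    by (intro mult_left_mono add_mono) (simp_all add: R_def N_def)
  also have "\<dots> = ennreal (k * ((a + b * q) * R ^ N + b * (R ^ DIM('a) * (2 / q))))"
    using k ab q(1) R
    by (simp add: q(2) ennreal_mult[symmetric] ennreal_plus[symmetric] del: ennreal_plus)
  also have "\<dots> \<le> ennreal (k * R ^ N * (a + 2 * b * q))"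
  proof -
    \<comment> \<open>This turns the contribution \<open>2 / q\<close> of the layer into at most
      \<open>R * q\<close>, a second copy of the outer contribution; hence the 2 in
      \<open>2 * b * q\<close>.\<close>
    have "2 * sqrt t \<le> R"
    proof -
      have "4 * t \<le> pi * (8 * t)" using t pi_gt3 by (simp add: mult_right_mono)
      then have "sqrt (4 * t) \<le> R" unfolding R_def by (rule real_sqrt_le_mono)
      then show ?thesis by (simp add: real_sqrt_mult)
    qed
    moreover have "sqrt t = 1 / q * (1 / q)"
      unfolding q(2)[symmetric] using t by simp
    ultimately have "2 / q \<le> R * q" using q by (simp add: field_simps)
    then have "b * (R ^ DIM('a) * (2 / q)) \<le> b * (R ^ DIM('a) * (R * q))"
      using ab R by (intro mult_left_mono) auto
    then have "k * ((a + b * q) * R ^ N + b * (R ^ DIM('a) * (2 / q))) \<le>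
        k * ((a + b * q) * R ^ N + b * (R ^ DIM('a) * (R * q)))"
      using k by (intro mult_left_mono) auto
    also have "\<dots> = k * R ^ N * (a + 2 * b * q)"
      by (simp add: N_def algebra_simps)
    finally show ?thesis by (rule ennreal_leI)
  qed
  finally have "\<bar>LINT y:half_space|lebesgue. dirichlet_kernel t x y * f y\<bar> \<le> k * R ^ N * (a + 2 * b * q)"
    using k R ab q by (intro abs_set_integral_le) auto
  moreover have "(4 * pi * t) powr (- real N / 2) = 1 / sqrt (4 * pi * t) ^ N"
  proof -
    have "sqrt (4 * pi * t) ^ N = sqrt (4 * pi * t) powr real N"
      using t by (simp add: powr_realpow)
    also have "\<dots> = (4 * pi * t) powr (real N / 2)"
      using t by (simp add: powr_half_sqrt[symmetric] powr_powr del: powr_half_sqrt)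
    finally show ?thesis by (simp add: powr_minus_divide)
  qed
  ultimately have "\<bar>S1 t f x\<bar> \<le> 1 / sqrt (4 * pi * t) ^ N * (k * R ^ N * (a + 2 * b * q))"
    using t unfolding S1_def N_def[symmetric] by (simp add: abs_mult divide_right_mono)
  also have "\<dots> = sqrt 2 ^ N * (k * (a + 2 * b * q))"
  proof -
    have "R = sqrt 2 * sqrt (4 * pi * t)" by (simp add: R_def real_sqrt_mult[symmetric])
    then show ?thesis using t by (simp add: power_mult_distrib)
  qed
  also have "\<dots> \<le> sqrt 2 ^ N * (6 * snd x * (a * t powr (-1/2) + b * t powr (-3/4)))"
  proof (rule mult_left_mono)
    have *: "t powr (-1/2) = 1 / sqrt t" "t powr (-3/4) = q / sqrt t"
      using t powr_add[of t "-1/4" "-1/2"]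
      by (auto simp: q_def powr_minus_divide powr_half_sqrt)
    have "0 \<le> snd x * a / sqrt t" using x0 ab t by simp
    moreover have "6 * snd x * (a * (1 / sqrt t) + b * (q / sqrt t)) - k * (a + 2 * b * q)
        = 3 * (snd x * a / sqrt t)"
      using t by (simp add: k_def field_simps)
    ultimately show "k * (a + 2 * b * q) \<le> 6 * snd x * (a * t powr (-1/2) + b * t powr (-3/4))"
      unfolding * by linarith
  qed simp
  finally show ?thesis unfolding N_def by (simp only: mult_ac)
qed

section \<open>The Poisson semigroup\<close>

text \<open>The mean value inequality on the convex set \<open>S\<close> bounds the difference
  quotients by \<open>g\<close>, so dominated convergence applies along every sequence tending to
  \<open>r\<close>.\<close>

lemma has_field_derivative_integral_dominated:
  fixes f f' :: "real \<Rightarrow> 'b \<Rightarrow> real"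
  assumes S: "open S" "convex S" "r \<in> S"
    and int: "\<And>u. u \<in> S \<Longrightarrow> integrable M (f u)"
    and meas: "f' r \<in> borel_measurable M"
    and deriv: "\<And>u y. u \<in> S \<Longrightarrow> ((\<lambda>u. f u y) has_real_derivative f' u y) (at u)"
    and g: "integrable M g" "AE y in M. \<forall>u\<in>S. \<bar>f' u y\<bar> \<le> g y"
  shows "((\<lambda>u. LINT y|M. f u y) has_real_derivative (LINT y|M. f' r y)) (at r)"
proof -
  have "((\<lambda>u. ((LINT y|M. f u y) - (LINT y|M. f r y)) / (u - r)) \<longlongrightarrow> (LINT y|M. f' r y)) (at r within S)"
    unfolding tendsto_at_iff_sequentially o_def
  proof (intro allI impI)
    fix X :: "nat \<Rightarrow> real"
    assume X: "\<forall>i. X i \<in> S - {r}" "X \<longlonglongrightarrow> r"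
    let ?q = "\<lambda>n y. (f (X n) y - f r y) / (X n - r)"
    have "(\<lambda>n. LINT y|M. ?q n y) \<longlonglongrightarrow> (LINT y|M. f' r y)"
    proof (rule integral_dominated_convergence[where w = g])
      show "AE y in M. (\<lambda>n. ?q n y) \<longlonglongrightarrow> f' r y"
      proof (rule AE_I2)
        fix y
        have "((\<lambda>u. (f u y - f r y) / (u - r)) \<longlongrightarrow> f' r y) (at r)"
          using deriv[OF S(3), of y] by (simp add: has_field_derivative_iff)
        then show "(\<lambda>n. ?q n y) \<longlonglongrightarrow> f' r y"
          using X unfolding tendsto_at_iff_sequentially[where s = UNIV] o_def by auto
      qed
      show "AE y in M. norm (?q n y) \<le> g y" for n
        using g(2)
      proof eventually_elim
        fix y assume y: "\<forall>u\<in>S. \<bar>f' u y\<bar> \<le> g y"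
        have "norm (f (X n) y - f r y) \<le> g y * norm (X n - r)"
          by (rule field_differentiable_bound[OF S(2) has_field_derivative_at_within[OF deriv]])
            (use X S y in auto)
        moreover have "0 < \<bar>X n - r\<bar>" using X(1) by auto
        ultimately show "norm (?q n y) \<le> g y"
          by (simp add: abs_divide field_simps)
      qed
      show "?q n \<in> borel_measurable M" for n
        using int[of "X n"] int[of r] X(1) S by auto
    qed (use g meas in auto)
    moreover have "(LINT y|M. ?q n y) = ((LINT y|M. f (X n) y) - (LINT y|M. f r y)) / (X n - r)" for n
      using int[of "X n"] int[of r] X(1) S by simp
    ultimately show "(\<lambda>n. ((LINT y|M. f (X n) y) - (LINT y|M. f r y)) / (X n - r)) \<longlonglongrightarrow> (LINT y|M. f' r y)"
      by (simp only:)
  qed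
  then show ?thesis
    unfolding has_field_derivative_iff at_within_open[OF S(3,1)] .
qed

text \<open>In the form on the right, \<open>\<rho>\<close> enters through one linear factor and one
  power that decreases in \<open>\<rho>\<close>; differentiation and domination both rely on
  this.\<close>

lemma poisson_factor_eq:
  fixes \<rho> z N :: real
  assumes "0 < \<rho>"
  shows "\<rho> powr (1 - N) * (1 + z\<^sup>2 / \<rho>\<^sup>2) powr (- N / 2) = \<rho> * (\<rho>\<^sup>2 + z\<^sup>2) powr (- N / 2)"
proof -
  have pos: "0 < \<rho>\<^sup>2 + z\<^sup>2" using assms by (simp add: add_pos_nonneg)
  have "1 + z\<^sup>2 / \<rho>\<^sup>2 = (\<rho>\<^sup>2 + z\<^sup>2) / \<rho>\<^sup>2" using assms by (simp add: field_simps)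
  then have "(1 + z\<^sup>2 / \<rho>\<^sup>2) powr (- N / 2) = (\<rho>\<^sup>2 + z\<^sup>2) powr (- N / 2) / (\<rho>\<^sup>2) powr (- N / 2)"
    using pos assms by (simp add: powr_divide)
  also have "(\<rho>\<^sup>2) powr (- N / 2) = \<rho> powr (- N)"
    using assms powr_powr[of \<rho> 2 "- N / 2"] by simp
  finally show ?thesis
    using assms by (simp add: powr_diff powr_minus field_simps)
qed

lemma has_derivative_poisson_factor:
  fixes \<rho> z N :: real
  assumes "0 < \<rho>"
  shows "((\<lambda>\<rho>. \<rho> * (\<rho>\<^sup>2 + z\<^sup>2) powr (- N / 2)) has_real_derivative
     (\<rho>\<^sup>2 + z\<^sup>2) powr (- N / 2) * (1 - N * \<rho>\<^sup>2 / (\<rho>\<^sup>2 + z\<^sup>2))) (at \<rho>)"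
proof -
  have pos: "0 < \<rho>\<^sup>2 + z\<^sup>2" using assms by (simp add: add_pos_nonneg)
  have "((\<lambda>\<rho>. (\<rho>\<^sup>2 + z\<^sup>2) powr (- N / 2)) has_real_derivative
      (- N / 2) * (\<rho>\<^sup>2 + z\<^sup>2) powr (- N / 2 - of_nat 1) * (2 * \<rho>)) (at \<rho>)"
    by (intro DERIV_fun_powr pos) (auto intro!: derivative_eq_intros)
  note D = DERIV_mult[OF DERIV_ident this]
  define X where "X = \<rho>\<^sup>2 + z\<^sup>2"
  have X: "0 < X" "X powr (- N / 2 - of_nat 1) = X powr (- N / 2) / X"
    using pos by (auto simp: X_def powr_diff)
  show ?thesis
    using D X(1) unfolding X_def[symmetric] X(2)
    by (elim DERIV_cong) (simp add: field_simps power2_eq_square)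
qed

lemma S2_eq:
  fixes \<psi> :: "'a::euclidean_space \<Rightarrow> real"
  assumes "0 < snd x + t"
  shows "S2 t \<psi> x = Gamma (real DIM('a \<times> real) / 2) / pi powr (real DIM('a \<times> real) / 2) *
    (LINT y|lebesgue. (snd x + t) *
      ((snd x + t)\<^sup>2 + (norm (fst x - y))\<^sup>2) powr (- real DIM('a \<times> real) / 2) * \<psi> y)"
  unfolding S2_def poisson_factor_eq[OF assms] ..

text \<open>The derivative of the Poisson kernel in \<open>\<rho> = x_N + t\<close> is at most
  \<open>(1 + N) / \<rho>\<close> times the kernel itself, so both bounds follow from the uniform
  mass of the kernel. The shift by \<open>s\<close> matches the derivative inside \<open>F2\<close>;
  \<open>s = 0\<close> gives \<open>F1\<close>.\<close>

lemma S2_bounds: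
  obtains C where "0 < C"
    "\<And>\<psi> B x t. \<lbrakk>\<psi> \<in> borel_measurable lebesgue; AE y in lebesgue. \<bar>\<psi> y\<bar> \<le> B; 0 \<le> B; 0 < snd x + t\<rbrakk>
       \<Longrightarrow> \<bar>S2 t \<psi> (x :: 'a::euclidean_space \<times> real)\<bar> \<le> C * B"
    "\<And>\<psi> B x t s. \<lbrakk>\<psi> \<in> borel_measurable lebesgue; AE y in lebesgue. \<bar>\<psi> y\<bar> \<le> B; 0 \<le> B; 0 < snd x + (t - s)\<rbrakk>
       \<Longrightarrow> \<bar>deriv (\<lambda>r. S2 (r - s) \<psi> (x :: 'a::euclidean_space \<times> real)) t\<bar> \<le> C * B / (snd x + (t - s))"
proof -
  define N where "N = real DIM('a \<times> real)"
  define G where "G = Gamma (N / 2) / pi powr (N / 2)"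
  have N: "0 < N" by (simp add: N_def)
  have G: "0 < G" using N by (simp add: G_def Gamma_real_pos)
  define P where "P \<rho> z = \<rho> * (\<rho>\<^sup>2 + (norm z)\<^sup>2) powr (- N / 2)" for \<rho> and z :: 'a
  define P' where "P' \<rho> z = (\<rho>\<^sup>2 + (norm z)\<^sup>2) powr (- N / 2) * (1 - N * \<rho>\<^sup>2 / (\<rho>\<^sup>2 + (norm z)\<^sup>2))"
    for \<rho> and z :: 'a
  have P0: "0 \<le> P \<rho> z" if "0 < \<rho>" for \<rho> z using that by (simp add: P_def)
  \<comment> \<open>Stated for all \<open>\<rho>\<close> above \<open>\<rho>0\<close> with the
    kernel frozen at \<open>\<rho>0\<close>: the case \<open>\<rho>0 = \<rho>\<close> gives the
    final bound, the case of half of \<open>\<rho>\<close> the integrable majorant for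
    differentiating under the integral.\<close>
  have P'_le: "\<bar>P' \<rho> z\<bar> \<le> (1 + N) * (P \<rho>0 z / \<rho>0)" if "0 < \<rho>0" "\<rho>0 \<le> \<rho>" for \<rho>0 \<rho> z
  proof -
    have "\<rho>0\<^sup>2 \<le> \<rho>\<^sup>2" using that by (simp add: power_mono)
    moreover have pos: "0 < \<rho>0\<^sup>2 + (norm z)\<^sup>2" "0 < \<rho>\<^sup>2 + (norm z)\<^sup>2" using that by (auto intro: add_pos_nonneg)
    ultimately have "(\<rho>\<^sup>2 + (norm z)\<^sup>2) powr (- N / 2) \<le> (\<rho>0\<^sup>2 + (norm z)\<^sup>2) powr (- N / 2)"
      using N by (intro powr_mono2') auto
    moreover have "\<bar>1 - N * \<rho>\<^sup>2 / (\<rho>\<^sup>2 + (norm z)\<^sup>2)\<bar> \<le> 1 + N"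
    proof -
      have "0 \<le> N * \<rho>\<^sup>2 / (\<rho>\<^sup>2 + (norm z)\<^sup>2)" "N * \<rho>\<^sup>2 / (\<rho>\<^sup>2 + (norm z)\<^sup>2) \<le> N"
        using pos N by (auto simp: divide_le_eq mult_left_mono)
      then show ?thesis using N by linarith
    qed
    ultimately have "\<bar>P' \<rho> z\<bar> \<le> (\<rho>0\<^sup>2 + (norm z)\<^sup>2) powr (- N / 2) * (1 + N)"
      unfolding P'_def abs_mult using N by (intro mult_mono) auto
    then show ?thesis using that by (simp add: P_def mult.commute)
  qed
  obtain c where c: "0 < c" "\<And>\<rho> x. 0 < \<rho> \<Longrightarrow> (\<integral>\<^sup>+y. ennreal (P \<rho> (x - y)) \<partial>lborel) \<le> ennreal c"
  proof -
    obtain c where "0 < c" and c: "\<forall>\<rho>>0. \<forall>x::'a. (\<integral>\<^sup>+y. ennreal (\<rho> powr (- real DIM('a)) *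
        (1 + (norm (x - y))\<^sup>2 / \<rho>\<^sup>2) powr (- real (DIM('a) + 1) / 2)) \<partial>lborel) \<le> ennreal c"
      using nn_integral_Poisson_kernel_bound by blast
    have "\<rho> powr (- real DIM('a)) * (1 + z\<^sup>2 / \<rho>\<^sup>2) powr (- real (DIM('a) + 1) / 2)
        = \<rho> * (\<rho>\<^sup>2 + z\<^sup>2) powr (- N / 2)" if "0 < \<rho>" for \<rho> z
      using poisson_factor_eq[OF that, of N z] by (simp add: N_def)
    then show thesis using that[OF \<open>0 < c\<close>] c by (simp add: P_def)
  qed
  have Pm [measurable]: "(\<lambda>y. P \<rho> (z - y)) \<in> borel_measurable borel" for \<rho> z
    unfolding P_def by measurable
  have P'm [measurable]: "(\<lambda>y. P' \<rho> (z - y)) \<in> borel_measurable borel" for \<rho> z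
    unfolding P'_def by measurable
  have Pm': "(\<lambda>y. P \<rho> (z - y)) \<in> borel_measurable lebesgue"
    "(\<lambda>y. P' \<rho> (z - y)) \<in> borel_measurable lebesgue" for \<rho> z
    by (rule measurable_completion; simp)+
  have Pi: "integrable lebesgue (\<lambda>y. P \<rho> (z - y))" if "0 < \<rho>" for \<rho> z
  proof (rule integrableI_bounded)
    have "(\<integral>\<^sup>+ y. ennreal (norm (P \<rho> (z - y))) \<partial>lebesgue) = (\<integral>\<^sup>+y. ennreal (P \<rho> (z - y)) \<partial>lborel)"
      unfolding nn_integral_completion using P0[OF that] by simp
    then show "(\<integral>\<^sup>+ y. ennreal (norm (P \<rho> (z - y))) \<partial>lebesgue) < \<infinity>"
      using c(2)[OF that, of z] by (simp add: order_le_less_trans)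
  qed (simp add: measurable_completion)
  define H where "H \<psi> z \<rho> = (LINT y|lebesgue. P \<rho> (z - y) * \<psi> y)" for \<psi> z \<rho>
  have bound: "\<bar>LINT y|lebesgue. k y * \<psi> y\<bar> \<le> A * c * B"
    if "AE y in lebesgue. \<bar>\<psi> y\<bar> \<le> B" "0 \<le> B" "0 < \<rho>" "0 \<le> A" "\<And>y. \<bar>k y\<bar> \<le> A * P \<rho> (z - y)"
    for k \<psi> :: "'a \<Rightarrow> real" and A B \<rho> z
  proof (rule abs_integral_le)
    have "(\<integral>\<^sup>+ y. ennreal \<bar>k y * \<psi> y\<bar> \<partial>lebesgue) \<le> (\<integral>\<^sup>+ y. ennreal (A * B) * ennreal (P \<rho> (z - y)) \<partial>lebesgue)"
    proof (intro nn_integral_mono_AE, use that(1) in eventually_elim)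
      fix y assume "\<bar>\<psi> y\<bar> \<le> B"
      then have "\<bar>k y * \<psi> y\<bar> \<le> (A * P \<rho> (z - y)) * B"
        unfolding abs_mult using that by (intro mult_mono) (auto intro: order_trans[OF abs_ge_zero])
      then show "ennreal \<bar>k y * \<psi> y\<bar> \<le> ennreal (A * B) * ennreal (P \<rho> (z - y))"
        using that P0[of \<rho> "z - y"] by (simp add: ennreal_mult[symmetric] ennreal_leI mult_ac)
    qed
    also have "\<dots> = ennreal (A * B) * (\<integral>\<^sup>+ y. ennreal (P \<rho> (z - y)) \<partial>lborel)"
      unfolding nn_integral_completion by (intro nn_integral_cmult) measurable
    also have "\<dots> \<le> ennreal (A * B) * ennreal c"
      using c(2)[OF that(3)] by (intro mult_left_mono) auto
    also have "\<dots> = ennreal (A * c * B)"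
      using that c by (simp add: ennreal_mult[symmetric] mult_ac)
    finally show "(\<integral>\<^sup>+ y. ennreal \<bar>k y * \<psi> y\<bar> \<partial>lebesgue) \<le> ennreal (A * c * B)" .
  qed (use that c in auto)
  have H_bound: "\<bar>H \<psi> z \<rho>\<bar> \<le> c * B"
    if "AE y in lebesgue. \<bar>\<psi> y\<bar> \<le> B" "0 \<le> B" "0 < \<rho>" for \<psi> B z \<rho>
    unfolding H_def using bound[OF that, of 1 "\<lambda>y. P \<rho> (z - y)" z] P0[OF that(3)] by simp
  have H_deriv: "(H \<psi> z has_real_derivative (LINT y|lebesgue. P' \<rho> (z - y) * \<psi> y)) (at \<rho>)"
    if "\<psi> \<in> borel_measurable lebesgue" "AE y in lebesgue. \<bar>\<psi> y\<bar> \<le> B" "0 \<le> B" "0 < \<rho>" for \<psi> B z \<rho>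
    unfolding H_def
  proof (rule has_field_derivative_integral_dominated[where S = "{\<rho>/2<..}"
        and g = "\<lambda>y. (1 + N) / (\<rho> / 2) * B * P (\<rho> / 2) (z - y)"])
    fix u assume u: "u \<in> {\<rho>/2<..}"
    then have u0: "0 < u" using that by auto
    have "integrable lebesgue (\<lambda>y. B * P u (z - y))"
      using Pi[OF u0] by simp
    then show "integrable lebesgue (\<lambda>y. P u (z - y) * \<psi> y)"
    proof (rule Bochner_Integration.integrable_bound)
      show "AE y in lebesgue. norm (P u (z - y) * \<psi> y) \<le> norm (B * P u (z - y))"
        using that(2)
      proof eventually_elim
        fix y assume "\<bar>\<psi> y\<bar> \<le> B"
        then show "norm (P u (z - y) * \<psi> y) \<le> norm (B * P u (z - y))"
          using P0[OF u0, of "z - y"] \<open>0 \<le> B\<close> by (simp add: abs_mult mult_left_mono mult.commute[of B])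
      qed
    qed (rule borel_measurable_times[OF Pm'(1) that(1)])
    show "((\<lambda>u. P u (z - y) * \<psi> y) has_real_derivative P' u (z - y) * \<psi> y) (at u)" for y
      unfolding P_def P'_def
      by (intro DERIV_cmult_right has_derivative_poisson_factor u0)
  next
    show "AE y in lebesgue. \<forall>u\<in>{\<rho>/2<..}. \<bar>P' u (z - y) * \<psi> y\<bar> \<le> (1 + N) / (\<rho> / 2) * B * P (\<rho> / 2) (z - y)"
      using that(2)
    proof eventually_elim
      fix y assume y: "\<bar>\<psi> y\<bar> \<le> B"
      show "\<forall>u\<in>{\<rho>/2<..}. \<bar>P' u (z - y) * \<psi> y\<bar> \<le> (1 + N) / (\<rho> / 2) * B * P (\<rho> / 2) (z - y)"
      proof
        fix u assume "u \<in> {\<rho>/2<..}"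
        then have "\<bar>P' u (z - y)\<bar> \<le> (1 + N) * (P (\<rho>/2) (z - y) / (\<rho>/2))"
          using that by (intro P'_le) auto
        with y have "\<bar>P' u (z - y) * \<psi> y\<bar> \<le> (1 + N) * (P (\<rho>/2) (z - y) / (\<rho>/2)) * B"
          unfolding abs_mult by (intro mult_mono) (auto intro: order_trans[OF abs_ge_zero])
        then show "\<bar>P' u (z - y) * \<psi> y\<bar> \<le> (1 + N) / (\<rho> / 2) * B * P (\<rho> / 2) (z - y)"
          by (simp only: mult_ac divide_inverse)
      qed
    qed
    show "integrable lebesgue (\<lambda>y. (1 + N) / (\<rho> / 2) * B * P (\<rho> / 2) (z - y))"
      using Pi[of "\<rho>/2" z] that by simp
    show "(\<lambda>y. P' \<rho> (z - y) * \<psi> y) \<in> borel_measurable lebesgue"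
      by (rule borel_measurable_times[OF Pm'(2) that(1)])
  qed (use that in auto)
  have S2_H: "S2 t \<psi> x = G * H \<psi> (fst x) (snd x + t)" if "0 < snd x + t" for t \<psi> and x :: "'a \<times> real"
    unfolding S2_eq[OF that] by (simp add: G_def H_def P_def N_def)
  show thesis
  proof (rule that[of "G * (1 + N) * c"])
    show "0 < G * (1 + N) * c" using G N c by simp
    fix \<psi> :: "'a \<Rightarrow> real" and B t and x :: "'a \<times> real"
    assume \<psi>: "\<psi> \<in> borel_measurable lebesgue" "AE y in lebesgue. \<bar>\<psi> y\<bar> \<le> B" "0 \<le> B"
    show "\<bar>S2 t \<psi> x\<bar> \<le> G * (1 + N) * c * B" if "0 < snd x + t"
    proof -
      have "\<bar>S2 t \<psi> x\<bar> \<le> G * (c * B)"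
        using H_bound[OF \<psi>(2,3) that, of "fst x"] G by (simp add: S2_H[OF that] abs_mult)
      also have "\<dots> \<le> (1 + N) * (G * (c * B))"
        using N G c \<psi>(3) by (simp add: distrib_right)
      finally show ?thesis by (simp add: mult_ac)
    qed
    show "\<bar>deriv (\<lambda>r. S2 (r - s) \<psi> x) t\<bar> \<le> G * (1 + N) * c * B / (snd x + (t - s))"
      if pos: "0 < snd x + (t - s)" for s
    proof -
      define \<rho> where "\<rho> = snd x + (t - s)"
      let ?D = "LINT y|lebesgue. P' \<rho> (fst x - y) * \<psi> y"
      have "((\<lambda>r. G * H \<psi> (fst x) (snd x + (r - s))) has_real_derivative G * (?D * 1)) (at t)"
        by (intro DERIV_cmult DERIV_chain2[where g = "\<lambda>r. snd x + (r - s)"])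
          (auto intro!: derivative_eq_intros H_deriv[OF \<psi>] simp: \<rho>_def pos)
      \<comment> \<open>The kernel formula is available only where \<open>snd x + (r - s)\<close> is
        positive, so the two functions of \<open>r\<close> are compared near
        \<open>t\<close>.\<close>
      moreover have "\<forall>\<^sub>F r in nhds t. G * H \<psi> (fst x) (snd x + (r - s)) = S2 (r - s) \<psi> x"
      proof -
        have "open {s - snd x<..}" "t \<in> {s - snd x<..}" using pos by auto
        then have "\<forall>\<^sub>F r in nhds t. r \<in> {s - snd x<..}" by (rule eventually_nhds_in_open)
        then show ?thesis by eventually_elim (simp add: S2_H)
      qed
      ultimately have "((\<lambda>r. S2 (r - s) \<psi> x) has_real_derivative G * (?D * 1)) (at t)"
        by (subst (asm) DERIV_cong_ev[OF refl _ refl]) auto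
      then have "deriv (\<lambda>r. S2 (r - s) \<psi> x) t = G * ?D"
        using DERIV_imp_deriv by fastforce
      moreover have "\<bar>?D\<bar> \<le> (1 + N) / \<rho> * c * B"
        using P'_le[of \<rho> \<rho>] pos N \<psi> by (intro bound[where \<rho> = \<rho> and z = "fst x"]) (auto simp: \<rho>_def)
      ultimately have "\<bar>deriv (\<lambda>r. S2 (r - s) \<psi> x) t\<bar> \<le> G * ((1 + N) / \<rho> * c * B)"
        using G by (simp add: abs_mult del: times_divide_eq_right times_divide_eq_left)
      then show ?thesis by (simp add: \<rho>_def mult_ac)
    qed
  qed
qed

text \<open>Measurability of a parameter integral needs a jointly measurable integrand, so
  \<open>\<psi>\<close>, which is only Lebesgue measurable, is replaced by a Borel function equal to
  it almost everywhere. The result is needed because \<open>Linf_norm\<close> is infinite on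
  non-measurable arguments.\<close>

lemma borel_measurable_S2:
  fixes \<psi> :: "'a::euclidean_space \<Rightarrow> real"
  assumes "\<psi> \<in> borel_measurable lebesgue"
  shows "S2 t \<psi> \<in> borel_measurable borel"
proof -
  obtain \<psi>' where [measurable]: "\<psi>' \<in> borel_measurable lborel" and ae: "AE y in lborel. \<psi> y = \<psi>' y"
    using completion_ex_borel_measurable_real[OF assms] by blast
  let ?k = "\<lambda>(x::'a \<times> real) y. (snd x + t) powr (1 - real DIM('a \<times> real)) *
        (1 + (norm (fst x - y))\<^sup>2 / (snd x + t)\<^sup>2) powr (- real DIM('a \<times> real) / 2)"
  have km: "?k x \<in> borel_measurable borel" for x by measurable
  have km': "?k x \<in> borel_measurable lebesgue" for x
    by (rule measurable_completion) (use km in simp)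
  have \<psi>': "\<psi>' \<in> borel_measurable lebesgue"
    by (rule measurable_completion) simp
  have "(LINT y|lebesgue. ?k x y * \<psi> y) = (LINT y|lborel. ?k x y * \<psi>' y)" for x
  proof -
    have "(LINT y|lebesgue. ?k x y * \<psi> y) = (LINT y|lebesgue. ?k x y * \<psi>' y)"
    proof (rule integral_cong_AE)
      show "AE y in lebesgue. ?k x y * \<psi> y = ?k x y * \<psi>' y"
        using AE_completion[OF ae] by eventually_elim simp
    qed (rule borel_measurable_times[OF km' assms] borel_measurable_times[OF km' \<psi>'])+
    also have "\<dots> = (LINT y|lborel. ?k x y * \<psi>' y)"
      by (intro integral_completion borel_measurable_times) (use km in simp_all)
    finally show ?thesis .
  qed
  then have "S2 t \<psi> = (\<lambda>x. Gamma (real DIM('a \<times> real) / 2) / pi powr (real DIM('a \<times> real) / 2) *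
      (LINT y|lborel. ?k x y * \<psi>' y))"
    by (simp add: S2_def fun_eq_iff)
  also have "\<dots> \<in> borel_measurable borel"
  proof (intro borel_measurable_times borel_measurable_const lborel.borel_measurable_lebesgue_integral)
    have [measurable]: "(\<lambda>x::'a \<times> real. fst x) \<in> borel_measurable borel"
      "(\<lambda>x::'a \<times> real. snd x) \<in> borel_measurable borel"
      by (intro borel_measurable_continuous_onI continuous_intros)+
    show "(\<lambda>(x, y). ?k x y * \<psi>' y) \<in> borel_measurable (borel \<Otimes>\<^sub>M lborel)"
      unfolding split_beta' by measurable
  qed
  finally show ?thesis .
qed

section \<open>Boundary traces and singular time integrals\<close>

lemma open_half_space: "open (half_space :: ('a::euclidean_space \<times> real) set)"
  unfolding half_space_def by (intro open_Collect_less continuous_intros)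

lemma closure_half_space: "closure half_space = {x :: 'a::euclidean_space \<times> real. 0 \<le> snd x}"
proof -
  have "half_space = {x :: 'a \<times> real. (0, 1) \<bullet> x > 0}"
    by (auto simp: half_space_def inner_prod_def)
  then show ?thesis
    using closure_halfspace_gt[of "(0, 1) :: 'a \<times> real" 0] by (simp add: inner_prod_def zero_prod_def)
qed

lemma Linf_AE_bound:
  assumes "Linf_norm S f < \<infinity>" "S \<in> sets lebesgue"
  obtains B where "0 \<le> B" "AE x in lebesgue. x \<in> S \<longrightarrow> \<bar>f x\<bar> \<le> B"
    "ennreal B = Linf_norm S f"
proof -
  define B where "B = enn2real (Linf_norm S f)"
  have B: "ennreal B = Linf_norm S f" "0 \<le> B"
    using assms by (auto simp: B_def)
  have "AE x in lebesgue_on S. ennreal \<bar>f x\<bar> \<le> ennreal B"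
    unfolding B(1) Linf_norm_def by (rule esssup_AE)
  then have "AE x in lebesgue. x \<in> S \<longrightarrow> \<bar>f x\<bar> \<le> B"
    using assms(2) B(2) by (simp add: AE_restrict_space_iff)
  with B show thesis by (intro that) auto
qed

text \<open>The exceptional set in \<open>S\<close> is open and null, hence empty; continuity
  extends the bound to the closure. This carries an essential bound in the open half-space over to
  the boundary, where the trace lives.\<close>

lemma AE_le_imp_le_closure:
  fixes f :: "'b::euclidean_space \<Rightarrow> real"
  assumes "open S" "continuous_on (closure S) f" "AE x in lebesgue. x \<in> S \<longrightarrow> f x \<le> B"
    and x: "x \<in> closure S"
  shows "f x \<le> B"
proof -
  define U where "U = S \<inter> f -` {B<..}"
  have "continuous_on S f"
    using assms(2) closure_subset continuous_on_subset by blast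
  then have "open U"
    unfolding U_def using assms(1) by (intro continuous_open_preimage) auto
  moreover have "negligible U"
  proof -
    have "AE x in lebesgue. x \<notin> U" using assms(3) by eventually_elim (auto simp: U_def)
    then have "U \<in> null_sets lebesgue"
      using \<open>open U\<close> by (simp add: AE_iff_null_sets borel_open)
    then show ?thesis by (simp add: negligible_iff_null_sets)
  qed
  ultimately have "U = {}" using open_not_negligible by blast
  then have "f y \<le> B" if "y \<in> S" for y
    using that by (force simp: U_def)
  with assms(2) x show ?thesis by (rule continuous_le_on_closure)
qed

text \<open>A triple \<open>(c, a, b)\<close> encodes one doubly singular term. The list form
  integrates at once all terms of a majorant, three in the case of the source of
  \<open>v\<close>.\<close>

lemma set_integral_beta_bound:
  fixes f :: "real \<Rightarrow> real"
  assumes t: "0 < t" and L: "\<forall>(c, a, b)\<in>set L. 0 \<le> c \<and> a < 1 \<and> b < 1"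
    and f: "\<And>s. 0 < s \<Longrightarrow> s < t \<Longrightarrow> \<bar>f s\<bar> \<le> (\<Sum>(c, a, b)\<leftarrow>L. c * ((t - s) powr (-a) * s powr (-b)))"
  shows "\<bar>LINT s:{0<..<t}|lebesgue. f s\<bar> \<le> (\<Sum>(c, a, b)\<leftarrow>L. c * (Beta (1 - b) (1 - a) * t powr (1 - a - b)))"
proof (rule abs_set_integral_le)
  have Beta_nonneg: "0 \<le> Beta (1 - b) (1 - a)" if "a < 1" "b < 1" for a b :: real
    using that by (simp add: Beta_def)
  have R: "0 \<le> (\<Sum>(c, a, b)\<leftarrow>L. c * ((t - s) powr (-a) * s powr (-b)))"
    "0 \<le> (\<Sum>(c, a, b)\<leftarrow>L. c * (Beta (1 - b) (1 - a) * t powr (1 - a - b)))"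
    if "\<forall>(c, a, b)\<in>set L. 0 \<le> c \<and> a < 1 \<and> b < 1" for s :: real and L :: "(real \<times> real \<times> real) list"
    using that by (auto intro!: sum_list_nonneg mult_nonneg_nonneg Beta_nonneg)
  have meas [measurable]: "(\<lambda>s. \<Sum>(c, a, b)\<leftarrow>L. c * ((t - s) powr (-a) * s powr (-b))) \<in> borel_measurable borel"
    for L :: "(real \<times> real \<times> real) list"
    by (induction L) (auto simp: split_beta)
  have eq: "(\<integral>\<^sup>+s\<in>{0<..<t}. ennreal (\<Sum>(c, a, b)\<leftarrow>L. c * ((t - s) powr (-a) * s powr (-b))) \<partial>lborel)
      = ennreal (\<Sum>(c, a, b)\<leftarrow>L. c * (Beta (1 - b) (1 - a) * t powr (1 - a - b)))"
    using L
  proof (induction L)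
    case (Cons p L)
    obtain c a b where p: "p = (c, a, b)" by (cases p)
    have cab: "0 \<le> c" "a < 1" "b < 1" and L: "\<forall>(c, a, b)\<in>set L. 0 \<le> c \<and> a < 1 \<and> b < 1"
      using Cons.prems by (auto simp: p)
    have 1: "(\<integral>\<^sup>+s\<in>{0<..<t}. ennreal (c * ((t - s) powr (-a) * s powr (-b))) \<partial>lborel)
        = ennreal (c * (Beta (1 - b) (1 - a) * t powr (1 - a - b)))"
      using cab t Beta_nonneg[OF cab(2,3)]
      by (simp add: ennreal_mult'[OF cab(1)] mult.assoc nn_integral_cmult nn_integral_beta)
    have "(\<integral>\<^sup>+s\<in>{0<..<t}. ennreal (\<Sum>(c, a, b)\<leftarrow>p # L. c * ((t - s) powr (-a) * s powr (-b))) \<partial>lborel)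
      = (\<integral>\<^sup>+s. ennreal (c * ((t - s) powr (-a) * s powr (-b))) * indicator {0<..<t} s
          + ennreal (\<Sum>(c, a, b)\<leftarrow>L. c * ((t - s) powr (-a) * s powr (-b))) * indicator {0<..<t} s \<partial>lborel)"
      using cab R(1)[OF L] by (intro nn_integral_cong) (auto simp: p indicator_def)
    also have "\<dots> = ennreal (c * (Beta (1 - b) (1 - a) * t powr (1 - a - b)))
      + ennreal (\<Sum>(c, a, b)\<leftarrow>L. c * (Beta (1 - b) (1 - a) * t powr (1 - a - b)))"
      by (subst nn_integral_add) (simp_all add: 1 Cons.IH[OF L])
    also have "\<dots> = ennreal (\<Sum>(c, a, b)\<leftarrow>p # L. c * (Beta (1 - b) (1 - a) * t powr (1 - a - b)))"
      using cab t Beta_nonneg[OF cab(2,3)] R(2)[OF L] by (simp add: p)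
    finally show ?case .
  qed simp
  have "(\<integral>\<^sup>+s\<in>{0<..<t}. ennreal \<bar>f s\<bar> \<partial>lebesgue) \<le>
      (\<integral>\<^sup>+s\<in>{0<..<t}. ennreal (\<Sum>(c, a, b)\<leftarrow>L. c * ((t - s) powr (-a) * s powr (-b))) \<partial>lebesgue)"
    using f by (intro nn_integral_mono) (auto simp: indicator_def intro: ennreal_leI)
  also have "\<dots> = ennreal (\<Sum>(c, a, b)\<leftarrow>L. c * (Beta (1 - b) (1 - a) * t powr (1 - a - b)))"
    unfolding nn_integral_completion by (rule eq)
  finally show "(\<integral>\<^sup>+s\<in>{0<..<t}. ennreal \<bar>f s\<bar> \<partial>lebesgue) \<le>
      ennreal (\<Sum>(c, a, b)\<leftarrow>L. c * (Beta (1 - b) (1 - a) * t powr (1 - a - b)))" .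
  show "0 \<le> (\<Sum>(c, a, b)\<leftarrow>L. c * (Beta (1 - b) (1 - a) * t powr (1 - a - b)))"
    using R(2)[OF L] .
qed

text \<open>Trades exponential decay for a power: applied to \<open>l * u\<close> it separates a
  small factor in \<open>l\<close> from a weak singularity in \<open>u\<close>.\<close>

lemma exp_minus_le_powr:
  fixes u :: real
  assumes "0 < u" "0 \<le> p" "p \<le> 1"
  shows "exp (- u) \<le> u powr (-p)"
proof -
  have "u powr p \<le> exp u"
  proof (cases "u \<le> 1")
    case True
    then have "u powr p \<le> 1" using assms by (simp add: powr_le1)
    also have "1 \<le> exp u" using assms by simp
    finally show ?thesis .
  next
    case False
    then have "u powr p \<le> u powr 1" using assms by (intro powr_mono) auto
    also have "\<dots> \<le> 1 + u" using assms by simp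
    also have "\<dots> \<le> exp u" by (rule exp_ge_add_one_self)
    finally show ?thesis .
  qed
  then show ?thesis
    using assms by (simp add: powr_minus exp_minus le_imp_inverse_le)
qed

text \<open>The inequality of arithmetic and geometric means distributes the singularity evenly over
  the two variables.\<close>

lemma inverse_add_le_powr:
  fixes a b :: real
  assumes "0 < a" "0 < b"
  shows "1 / (a + b) \<le> a powr (-1/2) * b powr (-1/2)"
proof -
  have "sqrt a * sqrt b \<le> a + b"
    using arith_geo_mean_sqrt[of a b] assms by (simp add: real_sqrt_mult)
  then have "1 / (a + b) \<le> 1 / (sqrt a * sqrt b)"
    using assms by (intro divide_left_mono) auto
  then show ?thesis
    using assms by (simp add: powr_minus_divide powr_half_sqrt)
qed

text \<open>Continuity and the linear bound force \<open>v\<close> to vanish at the boundary point.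
  Hence \<open>v (y, r) t / r\<close> is a difference quotient bounded by \<open>b\<close>, and so
  is its limit.\<close>

lemma normal_trace_bound:
  fixes v :: "'a::euclidean_space \<times> real \<Rightarrow> real \<Rightarrow> real"
  assumes cont: "continuous_on (closure half_space) (\<lambda>x. v x t)"
    and diff: "normal_differentiable (\<lambda>x. v x t) (y, 0)"
    and bound: "\<And>x. x \<in> half_space \<Longrightarrow> \<bar>v x t\<bar> \<le> snd x * b"
  shows "\<bar>normal_trace v t y\<bar> \<le> b"
proof -
  define f where "f r = v (y, r) t" for r
  let ?F = "at (0::real) within {0..}"
  have nontriv: "?F \<noteq> bot"
    by (simp add: at_within_Ici_at_right trivial_limit_at_right_real)
  have pos: "eventually (\<lambda>r. 0 < r) ?F"
    by (simp add: eventually_at_filter)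
  have fb: "\<bar>f r\<bar> \<le> r * b" if "0 < r" for r
    using bound[of "(y, r)"] that by (simp add: f_def half_space_def)
  have "continuous_on {0..} f"
    unfolding f_def
    by (rule continuous_on_compose2[OF cont]) (auto intro!: continuous_intros simp: closure_half_space)
  then have "(f \<longlongrightarrow> f 0) ?F"
    by (simp add: continuous_on)
  moreover have "(f \<longlongrightarrow> 0) ?F"
  proof (rule Lim_null_comparison)
    show "eventually (\<lambda>r. norm (f r) \<le> r * b) ?F"
      using pos by eventually_elim (simp add: fb)
    show "((\<lambda>r. r * b) \<longlongrightarrow> 0) ?F"
      by (auto intro!: tendsto_eq_intros)
  qed
  ultimately have f0: "f 0 = 0" using nontriv tendsto_unique by blast
  define d where "d = vector_derivative f ?F"
  have "(f has_vector_derivative d) ?F"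
    using diff unfolding normal_differentiable_def d_def f_def by (simp add: vector_derivative_works)
  then have "(f has_real_derivative d) ?F"
    by (simp add: has_real_derivative_iff_has_vector_derivative)
  then have "((\<lambda>r. f r / r) \<longlongrightarrow> d) ?F"
    by (simp add: has_field_derivative_iff f0)
  then have "((\<lambda>r. \<bar>f r / r\<bar>) \<longlongrightarrow> \<bar>d\<bar>) ?F" by (rule tendsto_rabs)
  moreover have "eventually (\<lambda>r. \<bar>f r / r\<bar> \<le> b) ?F"
    using pos by eventually_elim (use fb in \<open>simp add: divide_le_eq mult.commute\<close>)
  ultimately have "\<bar>d\<bar> \<le> b"
    using nontriv by (rule tendsto_upperbound)
  then show ?thesis
    by (simp add: normal_trace_def normal_deriv_def d_def f_def[abs_def])
qed

section \<open>A priori estimates uniform in \<open>\<epsilon>\<close>\<close>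

lemma global_solution_continuous_on:
  fixes v w :: "'a::euclidean_space \<times> real \<Rightarrow> real \<Rightarrow> real"
  assumes sol: "global_solution \<epsilon> \<phi> \<phi>b v w" and t: "0 < t"
  shows "continuous_on (closure half_space) (\<lambda>x. v x t)"
    and "continuous_on (closure half_space) (normal_deriv (\<lambda>x. v x t))"
    and "continuous_on (closure half_space) (\<lambda>x. w x t)"
proof -
  have slice: "continuous_on (closure half_space) (\<lambda>x. f x t)"
    if "continuous_on (closure half_space \<times> {0<..}) (\<lambda>(x, t). f x t)" for f :: "'a \<times> real \<Rightarrow> real \<Rightarrow> real"
  proof -
    have "continuous_on (closure half_space) (\<lambda>x. (\<lambda>(x, t). f x t) (x, t))"
      by (rule continuous_on_compose2[OF that]) (use t in \<open>auto intro!: continuous_intros\<close>)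
    then show ?thesis by simp
  qed
  note c = sol[unfolded global_solution_def]
  show "continuous_on (closure half_space) (\<lambda>x. v x t)"
    using c by (intro slice) blast
  show "continuous_on (closure half_space) (normal_deriv (\<lambda>x. v x t))"
    using c by (intro slice[of "\<lambda>x t. normal_deriv (\<lambda>z. v z t) x"]) blast
  show "continuous_on (closure half_space) (\<lambda>x. w x t)"
    using c by (intro slice) blast
qed

lemma global_solution_trace_measurable:
  fixes v :: "'a::euclidean_space \<times> real \<Rightarrow> real \<Rightarrow> real"
  assumes "global_solution \<epsilon> \<phi> \<phi>b v w" "0 < s"
  shows "normal_trace v s \<in> borel_measurable lebesgue"
proof -
  have "continuous_on UNIV (\<lambda>y. normal_deriv (\<lambda>x. v x s) (y, 0))"
    by (rule continuous_on_compose2[OF global_solution_continuous_on(2)[OF assms]])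
      (auto intro!: continuous_intros simp: closure_half_space)
  then have "normal_trace v s \<in> borel_measurable borel"
    by (intro borel_measurable_continuous_onI) (simp add: normal_trace_def[abs_def])
  then show ?thesis by (intro measurable_completion) simp
qed

text \<open>Here \<open>B\<close> may depend on \<epsilon> and on the solution. It only provides the
  finite starting value of the later iteration.\<close>

lemma locally_bounded_trace:
  fixes v :: "'a::euclidean_space \<times> real \<Rightarrow> real \<Rightarrow> real"
  assumes sol: "global_solution \<epsilon> \<phi> \<phi>b v w" and bdd: "locally_bounded_solution \<epsilon> v w"
    and \<epsilon>: "0 < \<epsilon>" and T: "0 < T"
  obtains B where "0 \<le> B" "\<And>t y. 0 < t \<Longrightarrow> t < T \<Longrightarrow> \<bar>normal_trace v t y\<bar> \<le> B * sqrt (\<epsilon> / t)"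
proof -
  let ?S = "SUP t\<in>{0<..<T}. Linf_norm half_space (\<lambda>x. v x t) +
        ennreal (sqrt (t / \<epsilon>)) * Linf_norm half_space (normal_deriv (\<lambda>x. v x t)) +
        Linf_norm half_space (\<lambda>x. w x t)"
  have "?S < \<infinity>" using bdd T by (simp add: locally_bounded_solution_def)
  then have "?S = ennreal (enn2real ?S)" by simp
  then obtain B where B: "0 \<le> B" "?S = ennreal B"
    using enn2real_nonneg by blast
  show thesis
  proof (rule that[OF B(1)])
    fix t and y :: 'a assume t: "0 < t" "t < T"
    let ?d = "normal_deriv (\<lambda>x. v x t)"
    have "ennreal (sqrt (t / \<epsilon>)) * Linf_norm half_space ?d \<le> ?S"
      by (rule SUP_upper2[of t]) (use t in \<open>auto intro: add_increasing add_increasing2\<close>)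
    then have le: "ennreal (sqrt (t / \<epsilon>)) * Linf_norm half_space ?d \<le> ennreal B"
      using B by simp
    \<comment> \<open>Since \<open>sqrt (t / \<epsilon>)\<close> is positive, an infinite norm would
      make the product infinite.\<close>
    have "Linf_norm half_space ?d < \<infinity>"
    proof (rule ccontr)
      assume "\<not> ?thesis"
      then have "Linf_norm half_space ?d = top" by (simp add: less_top[symmetric])
      with le t \<epsilon> show False by (simp add: ennreal_mult_top top_unique)
    qed
    then obtain D where D: "0 \<le> D" "AE x in lebesgue. x \<in> half_space \<longrightarrow> \<bar>?d x\<bar> \<le> D"
      "ennreal D = Linf_norm half_space ?d"
      by (rule Linf_AE_bound) (simp add: open_half_space borel_open)
    have "sqrt (t / \<epsilon>) * D \<le> B"
      using le t \<epsilon> B(1) D(1) unfolding D(3)[symmetric] by (simp add: ennreal_mult[symmetric])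
    then have "D \<le> B * sqrt (\<epsilon> / t)"
      using t \<epsilon> by (simp add: real_sqrt_divide field_simps)
    moreover have "\<bar>?d (y, 0)\<bar> \<le> D"
    proof (rule AE_le_imp_le_closure[OF open_half_space _ D(2)])
      show "continuous_on (closure half_space) (\<lambda>x. \<bar>?d x\<bar>)"
        by (intro continuous_on_rabs global_solution_continuous_on[OF sol t(1)])
    qed (simp add: closure_half_space)
    ultimately show "\<bar>normal_trace v t y\<bar> \<le> B * sqrt (\<epsilon> / t)"
      by (simp add: normal_trace_def)
  qed
qed

text \<open>\<open>C1\<close> collects the initial data and \<open>F1\<close>, while
  \<open>C2\<close> measures the feedback of the trace through \<open>F2\<close>. Both are fixed
  before \<epsilon>, \<open>l\<close> and \<open>A\<close>, so that \<open>l\<close> can afterwards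
  be chosen in terms of \<open>C2\<close> alone.\<close>

lemma global_solution_a_priori:
  fixes \<phi> :: "'a::euclidean_space \<times> real \<Rightarrow> real" and \<phi>b :: "'a \<Rightarrow> real"
  assumes \<phi>: "\<phi> \<in> Linf half_space" and \<phi>b: "\<phi>b \<in> Linf UNIV" and T: "0 < T"
  obtains C1 C2 where "0 \<le> C1" "0 \<le> C2"
    "\<And>\<epsilon> v w l A x t. \<lbrakk>0 < \<epsilon>; \<epsilon> < 1; global_solution \<epsilon> \<phi> \<phi>b v w; 0 < l; 0 \<le> A;
        \<And>t y. \<lbrakk>0 < t; t < T\<rbrakk> \<Longrightarrow> \<bar>normal_trace v t y\<bar> \<le> A * exp (l * t) * sqrt (\<epsilon> / t);
        x \<in> half_space; 0 < t; t < T\<rbrakk>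
      \<Longrightarrow> \<bar>v x t\<bar> \<le> snd x * ((C1 + A * exp (l * t) * l powr (-1/8) * C2) * sqrt (\<epsilon> / t))"
proof -
  obtain C where C: "0 < C"
    "\<And>\<psi> B x t. \<lbrakk>\<psi> \<in> borel_measurable lebesgue; AE y in lebesgue. \<bar>\<psi> y\<bar> \<le> B; 0 \<le> B; 0 < snd x + t\<rbrakk>
       \<Longrightarrow> \<bar>S2 t \<psi> (x :: 'a \<times> real)\<bar> \<le> C * B"
    "\<And>\<psi> B x t s. \<lbrakk>\<psi> \<in> borel_measurable lebesgue; AE y in lebesgue. \<bar>\<psi> y\<bar> \<le> B; 0 \<le> B; 0 < snd x + (t - s)\<rbrakk>
       \<Longrightarrow> \<bar>deriv (\<lambda>r. S2 (r - s) \<psi> (x :: 'a \<times> real)) t\<bar> \<le> C * B / (snd x + (t - s))"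
    by (rule S2_bounds) blast
  obtain B0 where B0: "0 \<le> B0" "AE x in lebesgue. x \<in> half_space \<longrightarrow> \<bar>\<phi> x\<bar> \<le> B0"
    by (rule Linf_AE_bound[of half_space \<phi>]) (use \<phi> in \<open>auto simp: Linf_def open_half_space borel_open\<close>)
  obtain Bb where Bb: "0 \<le> Bb" "AE y in lebesgue. \<bar>\<phi>b y\<bar> \<le> Bb"
    by (rule Linf_AE_bound[of UNIV \<phi>b]) (use \<phi>b in \<open>auto simp: Linf_def\<close>)
  have \<phi>bm: "\<phi>b \<in> borel_measurable lebesgue"
    using \<phi>b by (simp add: Linf_def lebesgue_on_UNIV_eq)
  define K where "K = 6 * sqrt 2 ^ DIM('a \<times> real)"
  have K: "0 \<le> K" by (simp add: K_def)
  define \<beta> where "\<beta> a b = Beta (1 - b) (1 - a)" for a b :: real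
  have \<beta>: "0 \<le> \<beta> a b" if "a < 1" "b < 1" for a b
    using that by (simp add: \<beta>_def Beta_def)
  define C1 where "C1 = K * (B0 + C * Bb + C * Bb * \<beta> (3/4) (1/2) * T powr (1/4))"
  define C2 where "C2 = K * C * (\<beta> (5/8) (1/2) * T powr (3/8) + \<beta> (1/2) (1/2) * \<beta> (7/8) 0 * T powr (5/8))"
  show thesis
  proof (rule that)
    show "0 \<le> C1" "0 \<le> C2"
      unfolding C1_def C2_def using K B0 Bb C(1) \<beta> by simp_all
    fix \<epsilon> l A t :: real and v w :: "'a \<times> real \<Rightarrow> real \<Rightarrow> real" and x :: "'a \<times> real"
    assume \<epsilon>: "0 < \<epsilon>" "\<epsilon> < 1" and sol: "global_solution \<epsilon> \<phi> \<phi>b v w" and l: "0 < l" and A: "0 \<le> A"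
      and tr: "\<And>t y. \<lbrakk>0 < t; t < T\<rbrakk> \<Longrightarrow> \<bar>normal_trace v t y\<bar> \<le> A * exp (l * t) * sqrt (\<epsilon> / t)"
      and x: "x \<in> half_space" and t: "0 < t" "t < T"
    note trm = global_solution_trace_measurable[OF sol]
    have x0: "0 < snd x" using x by (simp add: half_space_def)
    have sq: "sqrt (\<epsilon> / s) = sqrt \<epsilon> * s powr (-1/2)" if "0 < s" for s
      using that by (simp add: real_sqrt_divide powr_minus_divide powr_half_sqrt)
    \<comment> \<open>\<open>E s * s powr (-1/2)\<close> bounds \<open>S2\<close> of the trace at
      time \<open>s\<close>. The power is split off because it takes part in the beta integrals,
      whereas \<open>E\<close> is increasing and can be pulled out of them.\<close>
    define E where "E s = C * (A * exp (l * s) * sqrt \<epsilon>)" for s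
    have E: "0 \<le> E s" for s using A C(1) \<epsilon> by (simp add: E_def)
    have h: "\<bar>F1 \<phi>b y s + F2 v y s\<bar> \<le> E s * s powr (-1/2) +
        (C * Bb * s powr (-1/2) + E s * \<beta> (1/2) (1/2)) * snd y powr (-1/2)"
      if y: "y \<in> half_space" and s: "0 < s" "s < T" for y s
    proof -
      have y0: "0 < snd y" using y by (simp add: half_space_def)
      have "\<bar>F1 \<phi>b y s\<bar> \<le> C * Bb / (snd y + s)"
        using C(3)[OF \<phi>bm Bb(2,1), of y s 0] y0 s by (simp add: F1_def)
      \<comment> \<open>\<open>1 / s\<close> would not be integrable at \<open>0\<close>; half of the singularity is moved to the boundary.\<close>
      also have "\<dots> = C * Bb * (1 / (snd y + s))" by simp
      also have "\<dots> \<le> C * Bb * (snd y powr (-1/2) * s powr (-1/2))"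
        using inverse_add_le_powr[OF y0 s(1)] C(1) Bb(1) by (intro mult_left_mono) auto
      finally have 1: "\<bar>F1 \<phi>b y s\<bar> \<le> C * Bb * s powr (-1/2) * snd y powr (-1/2)"
        by (simp add: mult_ac)
      have trs: "\<bar>S2 0 (normal_trace v s) y\<bar> \<le> C * (A * exp (l * s) * sqrt (\<epsilon> / s))"
        using tr[OF s] A \<epsilon> s y0 by (intro C(2) trm) auto
      then have 2: "\<bar>S2 0 (normal_trace v s) y\<bar> \<le> E s * s powr (-1/2)"
        using s by (simp add: E_def sq mult_ac)
      have 3: "\<bar>LINT r:{0<..<s}|lebesgue. deriv (\<lambda>q. S2 (q - r) (normal_trace v r) y) s\<bar>
          \<le> E s * \<beta> (1/2) (1/2) * snd y powr (-1/2)"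
      proof -
        have "\<bar>deriv (\<lambda>q. S2 (q - r) (normal_trace v r) y) s\<bar>
          \<le> E s * snd y powr (-1/2) * ((s - r) powr (-(1/2)) * r powr (-(1/2)))"
          if r: "0 < r" "r < s" for r
        proof -
          have rT: "r < T" using r s by simp
          have "\<bar>deriv (\<lambda>q. S2 (q - r) (normal_trace v r) y) s\<bar>
            \<le> C * (A * exp (l * r) * sqrt (\<epsilon> / r)) / (snd y + (s - r))"
            using tr[OF r(1) rT] A \<epsilon> r y0 by (intro C(3) trm) auto
          also have "\<dots> = E r * r powr (-1/2) * (1 / (snd y + (s - r)))"
            using r by (simp add: E_def sq mult_ac)
          also have "\<dots> \<le> E s * r powr (-1/2) * (snd y powr (-1/2) * (s - r) powr (-1/2))"
          proof (intro mult_mono)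
            show "E r \<le> E s"
              unfolding E_def using C(1) A \<epsilon> l r by (intro mult_left_mono mult_right_mono) auto
            show "1 / (snd y + (s - r)) \<le> snd y powr (-1/2) * (s - r) powr (-1/2)"
              using y0 r by (intro inverse_add_le_powr) auto
          qed (use E y0 r in auto)
          finally show ?thesis by (simp add: mult_ac)
        qed
        \<comment> \<open>With both exponents equal to 1/2 the integral over \<open>r\<close> is
          proportional to \<open>s powr 0\<close>, so no power of \<open>s\<close> remains.\<close>
        then show ?thesis
          using set_integral_beta_bound[of s "[(E s * snd y powr (-1/2), 1/2, 1/2)]"
              "\<lambda>r. deriv (\<lambda>q. S2 (q - r) (normal_trace v r) y) s"] s E
          by (simp add: \<beta>_def mult_ac)
      qed
      have "\<bar>F1 \<phi>b y s + F2 v y s\<bar> \<le> \<bar>F1 \<phi>b y s\<bar> + (\<bar>S2 0 (normal_trace v s) y\<bar> +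
          \<bar>LINT r:{0<..<s}|lebesgue. deriv (\<lambda>q. S2 (q - r) (normal_trace v r) y) s\<bar>)"
        unfolding F2_def by linarith
      with 1 2 3 show ?thesis by (simp add: algebra_simps)
    qed
    define \<kappa> where "\<kappa> = A * exp (l * t) * l powr (-1/8)"
    have \<kappa>: "0 \<le> \<kappa>" using A by (simp add: \<kappa>_def)
    define k where "k = K * snd x * sqrt \<epsilon>"
    have k: "0 \<le> k" using K x0 \<epsilon> by (simp add: k_def)
    have \<epsilon>34: "\<epsilon> powr (3/4) \<le> sqrt \<epsilon>"
      using \<epsilon> powr_mono'[of "1/2" "3/4" \<epsilon>] by (simp add: powr_half_sqrt)
    have sq1: "sqrt \<epsilon> \<le> 1" using \<epsilon> by simp
    have v1: "\<bar>S1 (t / \<epsilon>) (\<lambda>y. \<phi> y - S2 0 \<phi>b y) x\<bar> \<le> k * ((B0 + C * Bb) * t powr (-1/2))"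
    proof -
      have "AE y in lebesgue. y \<in> half_space \<longrightarrow> \<bar>\<phi> y - S2 0 \<phi>b y\<bar> \<le> (B0 + C * Bb) + 0 * snd y powr (-1/2)"
        using B0(2)
      proof eventually_elim
        fix y assume y: "y \<in> half_space \<longrightarrow> \<bar>\<phi> y\<bar> \<le> B0"
        show "y \<in> half_space \<longrightarrow> \<bar>\<phi> y - S2 0 \<phi>b y\<bar> \<le> (B0 + C * Bb) + 0 * snd y powr (-1/2)"
        proof
          assume hs: "y \<in> half_space"
          then have "\<bar>S2 0 \<phi>b y\<bar> \<le> C * Bb"
            by (intro C(2) \<phi>bm Bb) (simp add: half_space_def)
          with y hs show "\<bar>\<phi> y - S2 0 \<phi>b y\<bar> \<le> (B0 + C * Bb) + 0 * snd y powr (-1/2)" by simp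
        qed
      qed
      then have "\<bar>S1 (t / \<epsilon>) (\<lambda>y. \<phi> y - S2 0 \<phi>b y) x\<bar> \<le>
          K * snd x * ((B0 + C * Bb) * (t / \<epsilon>) powr (-1/2) + 0 * (t / \<epsilon>) powr (-3/4))"
        unfolding K_def using t \<epsilon> B0 Bb C(1) x by (intro S1_bound) auto
      moreover have "(t / \<epsilon>) powr (-1/2) = sqrt \<epsilon> * t powr (-1/2)"
        using t \<epsilon> by (simp add: powr_divide powr_minus_divide powr_half_sqrt)
      ultimately show ?thesis by (simp add: k_def mult_ac)
    qed
    have v2: "\<bar>S1 ((t - s) / \<epsilon>) (\<lambda>y. F1 \<phi>b y s + F2 v y s) x\<bar> \<le>
        k * C * \<kappa> * ((t - s) powr (-(5/8)) * s powr (-(1/2)))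
        + k * C * Bb * ((t - s) powr (-(3/4)) * s powr (-(1/2)))
        + k * C * \<kappa> * \<beta> (1/2) (1/2) * ((t - s) powr (-(7/8)) * s powr (-0))"
      if s: "0 < s" "s < t" for s
    proof -
      define u where "u = t - s"
      have u: "0 < u" using s by (simp add: u_def)
      have sT: "s < T" using s t by simp
      have Es: "E s \<le> C * \<kappa> * sqrt \<epsilon> * u powr (-1/8)"
      proof -
        \<comment> \<open>The exponential weight yields the small factor \<open>l powr (-1/8)\<close> at the price of a singularity
          that remains integrable after multiplication by \<open>u powr (-3/4)\<close>.\<close>
        have "exp (l * s) = exp (l * t) * exp (- (l * u))"
          by (simp add: u_def exp_add[symmetric] algebra_simps)
        also have "\<dots> \<le> exp (l * t) * (l * u) powr (-(1/8))"
          using l u by (intro mult_left_mono exp_minus_le_powr) auto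
        also have "\<dots> = exp (l * t) * (l powr (-1/8) * u powr (-1/8))"
          using l u by (simp add: powr_mult)
        finally have "C * A * sqrt \<epsilon> * exp (l * s) \<le> C * A * sqrt \<epsilon> * (exp (l * t) * (l powr (-1/8) * u powr (-1/8)))"
          using C(1) A \<epsilon> by (intro mult_left_mono) auto
        then show ?thesis by (simp add: E_def \<kappa>_def mult_ac)
      qed
      have e1: "(u / \<epsilon>) powr (-1/2) = sqrt \<epsilon> * u powr (-1/2)"
        using u \<epsilon> by (simp add: powr_divide powr_minus_divide powr_half_sqrt)
      have e2: "(u / \<epsilon>) powr (-3/4) \<le> sqrt \<epsilon> * u powr (-3/4)"
      proof -
        have "(u / \<epsilon>) powr (-3/4) = \<epsilon> powr (3/4) * u powr (-3/4)"
          using u \<epsilon> by (simp add: powr_divide powr_minus_divide)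
        then show ?thesis using \<epsilon>34 by (simp add: mult_right_mono)
      qed
      have "\<bar>S1 (u / \<epsilon>) (\<lambda>y. F1 \<phi>b y s + F2 v y s) x\<bar> \<le>
          K * snd x * (E s * s powr (-1/2) * (u / \<epsilon>) powr (-1/2)
            + (C * Bb * s powr (-1/2) + E s * \<beta> (1/2) (1/2)) * (u / \<epsilon>) powr (-3/4))"
        unfolding K_def
      proof (intro S1_bound AE_I2 impI h x s sT)
        show "0 \<le> C * Bb * s powr (-1/2) + E s * \<beta> (1/2) (1/2)"
          using C(1) Bb E \<beta>[of "1/2" "1/2"] by simp
      qed (use u \<epsilon> E in auto)
      also have "\<dots> \<le> K * snd x * (C * \<kappa> * 1 * u powr (-1/8) * s powr (-1/2) * (sqrt \<epsilon> * u powr (-1/2))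
            + (C * Bb * s powr (-1/2) + C * \<kappa> * 1 * u powr (-1/8) * \<beta> (1/2) (1/2)) * (sqrt \<epsilon> * u powr (-3/4)))"
      proof -
        \<comment> \<open>The \<open>sqrt \<epsilon>\<close> contained in \<open>E\<close> can be
          given away: the scaling of \<open>S1\<close> already supplies the one that is
          wanted.\<close>
        have "C * \<kappa> * sqrt \<epsilon> * u powr (-1/8) \<le> C * \<kappa> * 1 * u powr (-1/8)"
          using C(1) \<kappa> sq1 by (intro mult_right_mono mult_left_mono) auto
        with Es have Es': "E s \<le> C * \<kappa> * 1 * u powr (-1/8)" by linarith
        show ?thesis
          unfolding e1 using Es' E C(1) \<kappa> Bb K x0 \<epsilon> \<beta>[of "1/2" "1/2"] e2
          by (intro mult_left_mono add_mono mult_mono add_nonneg_nonneg mult_nonneg_nonneg order_refl) auto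
      qed
      \<comment> \<open>The weight adds 1/8 to the semigroup exponents: 5/8 = 1/2 + 1/8 and 7/8 =
        3/4 + 1/8. The last term is not singular at \<open>s = 0\<close>; \<open>s powr (-0)\<close>
        fits it to the format of triples.\<close>
      also have "\<dots> = k * C * \<kappa> * (u powr (-(5/8)) * s powr (-(1/2)))
        + k * C * Bb * (u powr (-(3/4)) * s powr (-(1/2)))
        + k * C * \<kappa> * \<beta> (1/2) (1/2) * (u powr (-(7/8)) * s powr (-0))"
      proof -
        have "u powr (-(5/8)) = u powr (-1/8) * u powr (-1/2)" "u powr (-(7/8)) = u powr (-1/8) * u powr (-3/4)"
          by (simp_all add: powr_add[symmetric])
        then show ?thesis using s by (simp add: k_def algebra_simps)
      qed
      finally show ?thesis by (simp add: u_def)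
    qed
    have v3: "\<bar>LINT s:{0<..<t}|lebesgue. S1 ((t - s) / \<epsilon>) (\<lambda>y. F1 \<phi>b y s + F2 v y s) x\<bar> \<le>
        k * C * \<kappa> * (\<beta> (5/8) (1/2) * t powr (-1/8))
        + (k * C * Bb * (\<beta> (3/4) (1/2) * t powr (-1/4))
        + k * C * \<kappa> * \<beta> (1/2) (1/2) * (\<beta> (7/8) 0 * t powr (1/8)))"
      using set_integral_beta_bound[of t "[(k * C * \<kappa>, 5/8, 1/2), (k * C * Bb, 3/4, 1/2),
          (k * C * \<kappa> * \<beta> (1/2) (1/2), 7/8, 0)]" "\<lambda>s. S1 ((t - s) / \<epsilon>) (\<lambda>y. F1 \<phi>b y s + F2 v y s) x"]
        t k C(1) \<kappa> Bb \<beta>[of "1/2" "1/2"] v2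
      by (simp add: \<beta>_def[symmetric] add.assoc)
    have "\<bar>v x t\<bar> \<le> \<bar>S1 (t / \<epsilon>) (\<lambda>y. \<phi> y - S2 0 \<phi>b y) x\<bar> +
        \<bar>LINT s:{0<..<t}|lebesgue. S1 ((t - s) / \<epsilon>) (\<lambda>y. F1 \<phi>b y s + F2 v y s) x\<bar>"
    proof -
      have "v x t = S1 (t / \<epsilon>) (\<lambda>y. \<phi> y - S2 0 \<phi>b y) x -
          (LINT s:{0<..<t}|lebesgue. S1 ((t - s) / \<epsilon>) (\<lambda>y. F1 \<phi>b y s + F2 v y s) x)"
        using sol x t(1) unfolding global_solution_def by blast
      then show ?thesis by linarith
    qed
    also have "\<dots> \<le> k * ((B0 + C * Bb) * t powr (-1/2)) + (k * C * \<kappa> * (\<beta> (5/8) (1/2) * t powr (-1/8))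
        + (k * C * Bb * (\<beta> (3/4) (1/2) * t powr (-1/4))
        + k * C * \<kappa> * \<beta> (1/2) (1/2) * (\<beta> (7/8) 0 * t powr (1/8))))"
      using v1 v3 by (rule add_mono)
    \<comment> \<open>Once \<open>t powr (-1/2)\<close> is extracted only nonnegative powers of
      \<open>t\<close> remain, and these are monotone, so \<open>T\<close> may replace
      \<open>t\<close>.\<close>
    also have "\<dots> = k * t powr (-1/2) * ((B0 + C * Bb) + (C * \<kappa> * (\<beta> (5/8) (1/2) * t powr (3/8))
        + (C * Bb * (\<beta> (3/4) (1/2) * t powr (1/4))
        + C * \<kappa> * \<beta> (1/2) (1/2) * (\<beta> (7/8) 0 * t powr (5/8)))))"
    proof -
      have "t powr (-1/8) = t powr (-1/2) * t powr (3/8)" "t powr (-1/4) = t powr (-1/2) * t powr (1/4)"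
        "t powr (1/8) = t powr (-1/2) * t powr (5/8)"
        by (simp_all add: powr_add[symmetric])
      then show ?thesis by (simp only: distrib_left mult_ac)
    qed
    also have "\<dots> \<le> k * t powr (-1/2) * ((B0 + C * Bb) + (C * \<kappa> * (\<beta> (5/8) (1/2) * T powr (3/8))
        + (C * Bb * (\<beta> (3/4) (1/2) * T powr (1/4))
        + C * \<kappa> * \<beta> (1/2) (1/2) * (\<beta> (7/8) 0 * T powr (5/8)))))"
      using k t C(1) \<kappa> Bb \<beta>
      by (intro mult_left_mono add_mono powr_mono2 order_refl mult_nonneg_nonneg) auto
    also have "\<dots> = snd x * ((C1 + \<kappa> * C2) * (sqrt \<epsilon> * t powr (-1/2)))"
      by (simp only: C1_def C2_def k_def distrib_left distrib_right mult_ac add_ac)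
    finally show "\<bar>v x t\<bar> \<le> snd x * ((C1 + A * exp (l * t) * l powr (-1/8) * C2) * sqrt (\<epsilon> / t))"
      using t by (simp only: sq \<kappa>_def)
  qed
qed

section \<open>Absorption of the trace, and the estimate on compact sets\<close>

text \<open>The integral equations hold in the open half-space only, while \<open>K\<close> may
  touch the boundary; a hyperplane is null and does not affect the essential supremum.\<close>

lemma AE_in_half_space:
  "AE x in lebesgue. x \<in> closure half_space \<longrightarrow> (x :: 'a::euclidean_space \<times> real) \<in> half_space"
proof -
  have "negligible {x :: 'a \<times> real. (0, 1) \<bullet> x = 0}"
    by (intro negligible_hyperplane) (simp add: zero_prod_def)
  then have "AE x in lebesgue. (x :: 'a \<times> real) \<notin> {x. (0, 1) \<bullet> x = 0}"
    unfolding negligible_iff_null_sets by (rule AE_not_in)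
  then show ?thesis
    unfolding closure_half_space by eventually_elim (auto simp: half_space_def inner_prod_def)
qed

lemma Linf_norm_le:
  assumes "f \<in> borel_measurable (lebesgue_on S)" "S \<in> sets lebesgue"
    "AE x in lebesgue. x \<in> S \<longrightarrow> \<bar>f x\<bar> \<le> B"
  shows "Linf_norm S f \<le> ennreal B"
  unfolding Linf_norm_def
proof (rule esssup_I)
  show "AE x in lebesgue_on S. ennreal \<bar>f x\<bar> \<le> ennreal B"
    using assms(2,3) by (auto simp: AE_restrict_space_iff intro: ennreal_leI)
qed (use assms(1) in measurable)

text \<open>The bound for \<open>v\<close> improves the bound for the trace, which improves the
  bound for \<open>v\<close> again. In the limit the starting constant \<open>B\<close> disappears
  and only \<open>2 * C1\<close> remains.\<close>

lemma global_solution_trace_bound: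
  fixes \<phi> :: "'a::euclidean_space \<times> real \<Rightarrow> real" and \<phi>b :: "'a \<Rightarrow> real"
  assumes \<phi>: "\<phi> \<in> Linf half_space" and \<phi>b: "\<phi>b \<in> Linf UNIV" and T: "0 < T"
  obtains C where "0 \<le> C"
    "\<And>\<epsilon> v w x t. \<lbrakk>0 < \<epsilon>; \<epsilon> < 1; global_solution \<epsilon> \<phi> \<phi>b v w; locally_bounded_solution \<epsilon> v w;
        x \<in> half_space; 0 < t; t < T\<rbrakk> \<Longrightarrow> \<bar>v x t\<bar> \<le> snd x * (C * sqrt (\<epsilon> / t))"
    "\<And>\<epsilon> v w y t. \<lbrakk>0 < \<epsilon>; \<epsilon> < 1; global_solution \<epsilon> \<phi> \<phi>b v w; locally_bounded_solution \<epsilon> v w;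
        0 < t; t < T\<rbrakk> \<Longrightarrow> \<bar>normal_trace v t y\<bar> \<le> C * sqrt (\<epsilon> / t)"
proof -
  obtain C1 C2 where C: "0 \<le> C1" "0 \<le> C2"
    "\<And>\<epsilon> v w l A x t. \<lbrakk>0 < \<epsilon>; \<epsilon> < 1; global_solution \<epsilon> \<phi> \<phi>b v w; 0 < l; 0 \<le> A;
        \<And>t y. \<lbrakk>0 < t; t < T\<rbrakk> \<Longrightarrow> \<bar>normal_trace v t y\<bar> \<le> A * exp (l * t) * sqrt (\<epsilon> / t);
        x \<in> half_space; 0 < t; t < T\<rbrakk>
      \<Longrightarrow> \<bar>v x t\<bar> \<le> snd x * ((C1 + A * exp (l * t) * l powr (-1/8) * C2) * sqrt (\<epsilon> / t))"
    by (rule global_solution_a_priori[OF \<phi> \<phi>b T]) blast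
  \<comment> \<open>Chosen so that \<open>l powr (1/8) = 2 * C2 + 1\<close>, whence the feedback
    factor is \<open>C2 / (2 * C2 + 1)\<close>, at most 1/2.\<close>
  define l where "l = (2 * C2 + 1) ^ 8"
  have l: "0 < l" using C(2) by (simp add: l_def)
  have l8: "l powr (-1/8) * C2 \<le> 1 / 2"
  proof -
    have "l = (2 * C2 + 1) powr real 8"
      using C(2) by (subst powr_realpow) (auto simp: l_def)
    then have "l powr (1/8) = (2 * C2 + 1) powr (real 8 * (1/8))"
      by (simp only: powr_powr)
    then have "l powr (1/8) = 2 * C2 + 1" using C(2) by simp
    then show ?thesis using C(2) by (simp add: powr_minus_divide field_simps)
  qed
  define C where "C = 2 * C1 * exp (l * T)"
  have trace: "\<bar>normal_trace v t y\<bar> \<le> 2 * C1 * exp (l * t) * sqrt (\<epsilon> / t)"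
    if \<epsilon>: "0 < \<epsilon>" "\<epsilon> < 1" and sol: "global_solution \<epsilon> \<phi> \<phi>b v w" "locally_bounded_solution \<epsilon> v w"
      and t: "0 < t" "t < T" for \<epsilon> v w t y
  proof -
    obtain B where B: "0 \<le> B" "\<And>t y. 0 < t \<Longrightarrow> t < T \<Longrightarrow> \<bar>normal_trace v t y\<bar> \<le> B * sqrt (\<epsilon> / t)"
      using locally_bounded_trace[OF sol \<epsilon>(1) T] by blast
    \<comment> \<open>The map from \<open>A\<close> to \<open>C1 + A / 2\<close> has the fixed point
      \<open>2 * C1\<close> and halves the distance to it. All \<open>t\<close> are treated together
      because \<open>v\<close> at one time depends on the trace at all earlier times.\<close>
    have "\<forall>t y. 0 < t \<longrightarrow> t < T \<longrightarrow>
        \<bar>normal_trace v t y\<bar> \<le> (2 * C1 + B / 2 ^ n) * exp (l * t) * sqrt (\<epsilon> / t)" for n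
    proof (induction n)
      case 0
      show ?case
      proof (intro allI impI)
        fix t and y :: 'a assume t: "0 < t" "t < T"
        have "B * 1 \<le> (2 * C1 + B) * exp (l * t)"
          using B(1) C(1) l t by (intro mult_mono) auto
        then have "B * sqrt (\<epsilon> / t) \<le> (2 * C1 + B) * exp (l * t) * sqrt (\<epsilon> / t)"
          using t \<epsilon> by (intro mult_right_mono) auto
        with B(2)[OF t, of y]
        show "\<bar>normal_trace v t y\<bar> \<le> (2 * C1 + B / 2 ^ 0) * exp (l * t) * sqrt (\<epsilon> / t)" by simp
      qed
    next
      case (Suc n)
      define A where "A = 2 * C1 + B / 2 ^ n"
      have A: "0 \<le> A" using C(1) B(1) by (simp add: A_def)
      show ?case
      proof (intro allI impI)
        fix t and y :: 'a assume t: "0 < t" "t < T"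
        show "\<bar>normal_trace v t y\<bar> \<le> (2 * C1 + B / 2 ^ Suc n) * exp (l * t) * sqrt (\<epsilon> / t)"
        proof (rule normal_trace_bound)
          show "continuous_on (closure half_space) (\<lambda>x. v x t)"
            by (rule global_solution_continuous_on(1)[OF sol(1) t(1)])
          show "normal_differentiable (\<lambda>x. v x t) (y, 0)"
            using sol(1) t unfolding global_solution_def by (auto simp: closure_half_space)
          fix x :: "'a \<times> real" assume x: "x \<in> half_space"
          \<comment> \<open>As \<open>exp (l * t)\<close> is at least 1, the constant
            \<open>C1\<close> can be put under the weight, and the bound regains the form of the
            induction hypothesis.\<close>
          have "C1 + A * exp (l * t) * l powr (-1/8) * C2
              = C1 * 1 + A * exp (l * t) * (l powr (-1/8) * C2)" by simp
          also have "\<dots> \<le> C1 * exp (l * t) + A * exp (l * t) * (1 / 2)"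
            using l8 A C(1) l t by (intro add_mono mult_left_mono) auto
          also have "\<dots> = (2 * C1 + B / 2 ^ Suc n) * exp (l * t)"
            by (simp add: A_def field_simps)
          finally have le: "C1 + A * exp (l * t) * l powr (-1/8) * C2 \<le> (2 * C1 + B / 2 ^ Suc n) * exp (l * t)" .
          have "\<bar>v x t\<bar> \<le> snd x * ((C1 + A * exp (l * t) * l powr (-1/8) * C2) * sqrt (\<epsilon> / t))"
            using Suc by (intro C(3)[OF \<epsilon> sol(1) l A _ x t]) (auto simp: A_def)
          also have "\<dots> \<le> snd x * ((2 * C1 + B / 2 ^ Suc n) * exp (l * t) * sqrt (\<epsilon> / t))"
            using le x \<epsilon> t by (intro mult_left_mono mult_right_mono) (auto simp: half_space_def)
          finally show "\<bar>v x t\<bar> \<le> snd x * ((2 * C1 + B / 2 ^ Suc n) * exp (l * t) * sqrt (\<epsilon> / t))" .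
        qed
      qed
    qed
    then have "\<bar>normal_trace v t y\<bar> \<le> (2 * C1 + B / 2 ^ n) * exp (l * t) * sqrt (\<epsilon> / t)" for n
      using t by blast
    moreover have "(\<lambda>n. (2 * C1 + B / 2 ^ n) * exp (l * t) * sqrt (\<epsilon> / t))
        \<longlonglongrightarrow> (2 * C1 + 0) * exp (l * t) * sqrt (\<epsilon> / t)"
      by (intro tendsto_intros LIMSEQ_divide_realpow_zero) simp
    ultimately show ?thesis
      by (intro LIMSEQ_le_const[of _ "2 * C1 * exp (l * t) * sqrt (\<epsilon> / t)"]) auto
  qed
  have le_C: "2 * C1 * exp (l * t) * sqrt (\<epsilon> / t) \<le> C * sqrt (\<epsilon> / t)" if "0 < t" "t < T" "0 < \<epsilon>" for t \<epsilon>
    unfolding C_def using that l C(1) by (intro mult_right_mono mult_left_mono) auto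
  show thesis
  proof (rule that)
    show "0 \<le> C" using C(1) by (simp add: C_def)
    fix \<epsilon> t :: real and v w :: "'a \<times> real \<Rightarrow> real \<Rightarrow> real" and x :: "'a \<times> real" and y :: 'a
    assume \<epsilon>: "0 < \<epsilon>" "\<epsilon> < 1" and sol: "global_solution \<epsilon> \<phi> \<phi>b v w" "locally_bounded_solution \<epsilon> v w"
      and t: "0 < t" "t < T"
    show "\<bar>normal_trace v t y\<bar> \<le> C * sqrt (\<epsilon> / t)"
      using trace[OF \<epsilon> sol t, of y] le_C[OF t \<epsilon>(1)] by linarith
    show "\<bar>v x t\<bar> \<le> snd x * (C * sqrt (\<epsilon> / t))" if x: "x \<in> half_space"
    proof -
      have "C1 + 2 * C1 * exp (l * t) * l powr (-1/8) * C2 =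
          C1 * 1 + 2 * C1 * exp (l * t) * (l powr (-1/8) * C2)" by simp
      also have "\<dots> \<le> C1 * exp (l * t) + 2 * C1 * exp (l * t) * (1 / 2)"
        using l8 C(1) l t by (intro add_mono mult_left_mono) auto
      also have "\<dots> = 2 * C1 * exp (l * t)" by simp
      finally have le: "C1 + 2 * C1 * exp (l * t) * l powr (-1/8) * C2 \<le> 2 * C1 * exp (l * t)" .
      have "\<bar>v x t\<bar> \<le> snd x * ((C1 + 2 * C1 * exp (l * t) * l powr (-1/8) * C2) * sqrt (\<epsilon> / t))"
        using C(1) by (intro C(3)[OF \<epsilon> sol(1) l _ trace[OF \<epsilon> sol] x t]) auto
      also have "\<dots> \<le> snd x * (2 * C1 * exp (l * t) * sqrt (\<epsilon> / t))"
        using le x \<epsilon> t by (intro mult_left_mono mult_right_mono) (auto simp: half_space_def)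
      also have "\<dots> \<le> snd x * (C * sqrt (\<epsilon> / t))"
        using le_C[OF t \<epsilon>(1)] x by (intro mult_left_mono) (auto simp: half_space_def)
      finally show ?thesis .
    qed
  qed
qed

theorem theorem4:
  fixes \<phi> :: "'a::euclidean_space \<times> real \<Rightarrow> real"
    and \<phi>b :: "'a \<Rightarrow> real"
    and K :: "('a \<times> real) set"
    and \<tau>1 \<tau>2 :: real
    and v w :: "real \<Rightarrow> 'a \<times> real \<Rightarrow> real \<Rightarrow> real"
  assumes "\<phi> \<in> Linf half_space"
    and "\<phi>b \<in> Linf UNIV"
    and "compact K" and "K \<subseteq> closure half_space"
    and "0 < \<tau>1" and "\<tau>1 < \<tau>2"
    and "\<And>\<epsilon>. \<epsilon> \<in> {0<..<1} \<Longrightarrow> global_solution \<epsilon> \<phi> \<phi>b (v \<epsilon>) (w \<epsilon>)"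
    and "\<And>\<epsilon>. \<epsilon> \<in> {0<..<1} \<Longrightarrow> locally_bounded_solution \<epsilon> (v \<epsilon>) (w \<epsilon>)"
  shows "\<exists>C>0. \<forall>\<epsilon>\<in>{0<..<1}.
    (SUP t\<in>{\<tau>1<..<\<tau>2}. Linf_norm K (\<lambda>x. (v \<epsilon> x t + w \<epsilon> x t) - S2 t \<phi>b x))
      \<le> ennreal (C * sqrt \<epsilon>)"
proof -
  have \<tau>2: "0 < \<tau>2" using assms(5,6) by simp
  obtain M where M: "0 \<le> M"
    "\<And>\<epsilon> v w x t. \<lbrakk>0 < \<epsilon>; \<epsilon> < 1; global_solution \<epsilon> \<phi> \<phi>b v w; locally_bounded_solution \<epsilon> v w;
        x \<in> half_space; 0 < t; t < \<tau>2\<rbrakk> \<Longrightarrow> \<bar>v x t\<bar> \<le> snd x * (M * sqrt (\<epsilon> / t))"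
    "\<And>\<epsilon> v w y t. \<lbrakk>0 < \<epsilon>; \<epsilon> < 1; global_solution \<epsilon> \<phi> \<phi>b v w; locally_bounded_solution \<epsilon> v w;
        0 < t; t < \<tau>2\<rbrakk> \<Longrightarrow> \<bar>normal_trace v t y\<bar> \<le> M * sqrt (\<epsilon> / t)"
    by (rule global_solution_trace_bound[OF assms(1,2) \<tau>2]) blast
  obtain P where P: "0 < P"
    "\<And>\<psi> B x t. \<lbrakk>\<psi> \<in> borel_measurable lebesgue; AE y in lebesgue. \<bar>\<psi> y\<bar> \<le> B; 0 \<le> B; 0 < snd x + t\<rbrakk>
       \<Longrightarrow> \<bar>S2 t \<psi> (x :: 'a \<times> real)\<bar> \<le> P * B"
    by (rule S2_bounds) blast
  obtain R where R: "0 < R" "\<And>x. x \<in> K \<Longrightarrow> norm x \<le> R"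
    using compact_imp_bounded[OF assms(3)] unfolding bounded_pos by blast
  \<comment> \<open>The integral of \<open>s powr (-1/2)\<close> over \<open>{0<..<t}\<close> is
    \<open>\<beta> * sqrt t\<close>.\<close>
  define \<beta> :: real where "\<beta> = Beta (1/2) 1"
  have \<beta>: "0 \<le> \<beta>" by (simp add: \<beta>_def Beta_def)
  \<comment> \<open>The first summand is for \<open>v\<close>, the second for
    \<open>w - S2 t \<phi>b\<close>; the third makes \<open>C\<close> positive even if
    \<open>M = 0\<close>.\<close>
  define C where "C = R * M / sqrt \<tau>1 + P * M * \<beta> * sqrt \<tau>2 + 1"
  have "0 < C"
    using R(1) M(1) P(1) \<beta> assms(5) \<tau>2 by (auto simp: C_def intro!: add_nonneg_pos add_nonneg_nonneg)
  moreover have "Linf_norm K (\<lambda>x. (v \<epsilon> x t + w \<epsilon> x t) - S2 t \<phi>b x) \<le> ennreal (C * sqrt \<epsilon>)"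
    if "\<epsilon> \<in> {0<..<1}" and t: "t \<in> {\<tau>1<..<\<tau>2}" for \<epsilon> t
  proof (rule Linf_norm_le)
    have \<epsilon>: "0 < \<epsilon>" "\<epsilon> < 1" and t0: "0 < t" "t < \<tau>2" "\<tau>1 < t"
      using that assms(5) by auto
    note sol = assms(7)[OF that(1)] assms(8)[OF that(1)]
    have K: "closed K" using assms(3) by (rule compact_imp_closed)
    then show Ks: "K \<in> sets lebesgue" by (simp add: borel_closed)
    have "continuous_on K (\<lambda>x. v \<epsilon> x t)" "continuous_on K (\<lambda>x. w \<epsilon> x t)"
      by (rule continuous_on_subset[OF global_solution_continuous_on(1)[OF sol(1) t0(1)] assms(4)]
          continuous_on_subset[OF global_solution_continuous_on(3)[OF sol(1) t0(1)] assms(4)])+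
    then have "(\<lambda>x. v \<epsilon> x t) \<in> borel_measurable (lebesgue_on K)" "(\<lambda>x. w \<epsilon> x t) \<in> borel_measurable (lebesgue_on K)"
      using Ks by (auto intro: continuous_imp_measurable_on_sets_lebesgue)
    moreover have "S2 t \<phi>b \<in> borel_measurable (lebesgue_on K)"
    proof (rule measurable_restrict_space1, rule measurable_completion)
      show "S2 t \<phi>b \<in> borel_measurable lborel"
        using borel_measurable_S2[of \<phi>b t] assms(2) by (simp add: Linf_def lebesgue_on_UNIV_eq)
    qed
    ultimately show "(\<lambda>x. (v \<epsilon> x t + w \<epsilon> x t) - S2 t \<phi>b x) \<in> borel_measurable (lebesgue_on K)"
      by (intro borel_measurable_diff borel_measurable_add)
    show "AE x in lebesgue. x \<in> K \<longrightarrow> \<bar>(v \<epsilon> x t + w \<epsilon> x t) - S2 t \<phi>b x\<bar> \<le> C * sqrt \<epsilon>"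
      using AE_in_half_space
    proof eventually_elim
      fix x :: "'a \<times> real" assume "x \<in> closure half_space \<longrightarrow> x \<in> half_space"
      then have hs: "x \<in> half_space" if "x \<in> K" using that assms(4) by blast
      show "x \<in> K \<longrightarrow> \<bar>(v \<epsilon> x t + w \<epsilon> x t) - S2 t \<phi>b x\<bar> \<le> C * sqrt \<epsilon>"
      proof
        assume xK: "x \<in> K"
        have x: "x \<in> half_space" by (rule hs[OF xK])
        then have x0: "0 < snd x" by (simp add: half_space_def)
        have "snd x \<le> R"
          using R(2)[OF xK] norm_snd_le[of "snd x" "fst x"] x0 by simp
        \<comment> \<open>The bound for \<open>v\<close> degenerates as \<open>t\<close> tends to 0;
          the distance \<open>\<tau>1\<close> from the initial time controls it.\<close>
        have "sqrt (\<epsilon> / t) \<le> sqrt \<epsilon> / sqrt \<tau>1"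
          unfolding real_sqrt_divide using t0 assms(5) \<epsilon> by (intro divide_left_mono) auto
        then have "snd x * (M * sqrt (\<epsilon> / t)) \<le> R * (M * (sqrt \<epsilon> / sqrt \<tau>1))"
          using \<open>snd x \<le> R\<close> x0 M(1) \<epsilon> t0 R(1) by (intro mult_mono) auto
        with M(2)[OF \<epsilon> sol x t0(1,2)] have 1: "\<bar>v \<epsilon> x t\<bar> \<le> R * M / sqrt \<tau>1 * sqrt \<epsilon>"
          by simp
        have w: "w \<epsilon> x t = S2 t \<phi>b x - (LINT s:{0<..<t}|lebesgue. S2 (t - s) (normal_trace (v \<epsilon>) s) x)"
          using sol(1) x t0(1) unfolding global_solution_def by blast
        have "\<bar>S2 (t - s) (normal_trace (v \<epsilon>) s) x\<bar> \<le> P * M * sqrt \<epsilon> * ((t - s) powr (-0) * s powr (-(1/2)))"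
          if s: "0 < s" "s < t" for s
        proof -
          have "\<bar>S2 (t - s) (normal_trace (v \<epsilon>) s) x\<bar> \<le> P * (M * sqrt (\<epsilon> / s))"
            using s t0 \<epsilon> M(1) x0
            by (intro P(2) global_solution_trace_measurable[OF sol(1)] AE_I2 M(3)[OF \<epsilon> sol]) auto
          then show ?thesis
            using s by (simp add: real_sqrt_divide powr_minus_divide powr_half_sqrt mult.assoc)
        qed
        then have "\<bar>LINT s:{0<..<t}|lebesgue. S2 (t - s) (normal_trace (v \<epsilon>) s) x\<bar>
            \<le> P * M * sqrt \<epsilon> * (\<beta> * sqrt t)"
          using set_integral_beta_bound[of t "[(P * M * sqrt \<epsilon>, 0, 1/2)]"
              "\<lambda>s. S2 (t - s) (normal_trace (v \<epsilon>) s) x"] t0 P(1) M(1) \<epsilon>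
          by (simp add: \<beta>_def powr_half_sqrt)
        also have "\<dots> \<le> P * M * sqrt \<epsilon> * (\<beta> * sqrt \<tau>2)"
          using P(1) M(1) \<epsilon> \<beta> t0 by (intro mult_left_mono) auto
        finally have 2: "\<bar>LINT s:{0<..<t}|lebesgue. S2 (t - s) (normal_trace (v \<epsilon>) s) x\<bar>
            \<le> P * M * \<beta> * sqrt \<tau>2 * sqrt \<epsilon>" by (simp only: mult_ac)
        have "C * sqrt \<epsilon> = R * M / sqrt \<tau>1 * sqrt \<epsilon> + P * M * \<beta> * sqrt \<tau>2 * sqrt \<epsilon> + sqrt \<epsilon>"
          by (simp add: C_def distrib_right)
        with 1 2 w show "\<bar>(v \<epsilon> x t + w \<epsilon> x t) - S2 t \<phi>b x\<bar> \<le> C * sqrt \<epsilon>"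
          using \<epsilon> by (smt (verit) real_sqrt_ge_zero)
      qed
    qed
  qed
  ultimately show ?thesis
    by (intro exI[of _ C] conjI ballI SUP_least) auto
qed

end
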